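(* Let $(\mathscr{A},\delta)$ be a discrete quantum group and let $\mathscr{B}$ be an algebra over $\mathbb{C}$ with non degenerate product. Let $Y\in M(\mathscr{B}\otimes\mathscr{A})$ be a multiplier of $\mathscr{B}\otimes\mathscr{A}$. Then $$Y\in M(\mathscr{B})\otimes M(\mathscr{A})\quad\Longleftrightarrow\quad \dim\bigl\{(\mathrm{id}\otimes\xi)(Y):\ \xi\in\widehat{\mathscr{A}}\,\bigr\}<\infty ,$$ where $M(\mathscr{B})\otimes M(\mathscr{A})$ (algebraic tensor product) is identified with its image under the natural embedding into $M(\mathscr{B}\otimes\mathscr{A})$.
   Context: All algebras are associative algebras over $\mathbb{C}$, not necessarily unital; all tensor products are algebraic. **Non degenerate product and multipliers.** An algebra $\mathscr{A}$ has non degenerate product if ($ab=0$ for all $b$ implies $a=0$) and ($ab=0$ for all $a$ implies $b=0$). For such $\mathscr{A}$, the multiplier algebra $M(\mathscr{A})$ is the space of pairs $(\lambda,\rho)$ of linear maps $\mathscr{A}\to\mathscr{A}$ (double centralizers) with $\rho(a)b=a\lambda(b)$ for all $a,b\in\mathscr{A}$. Such a pair is written as one element $m$ (a multiplier) with $ma=\lambda(a)$, $am=\rho(a)$; the product is composition: $(m_1m_2)a=m_1(m_2a)$, $a(m_1m_2)=(am_1)m_2$. The unit of $M(\mathscr{A})$ is denoted $I$, and $\mathscr{A}\subset M(\mathscr{A})$. If $\mathscr{A},\mathscr{B}$ have non degenerate products, so does $\mathscr{B}\otimes\mathscr{A}$, and $M(\mathscr{B})\otimes M(\mathscr{A})$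 embeds naturally into $M(\mathscr{B}\otimes\mathscr{A})$ by $(m\otimes n)(b\otimes a)=mb\otimes na$, $(b\otimes a)(m\otimes n)=bm\otimes an$. **Reduced functionals.** $\mathscr{A}^\sharp$ denotes the space of all linear functionals on $\mathscr{A}$. For $f\in\mathscr{A}^\sharp$ and $a\in\mathscr{A}$ put $(af)(b)=f(ba)$ and $(fa)(b)=f(ab)$ for $b\in\mathscr{A}$. The space of reduced functionals is $\mathscr{A}^*=\mathrm{span}\{afb:\ a,b\in\mathscr{A},\ f\in\mathscr{A}^\sharp\}$. Each reduced functional extends naturally to $M(\mathscr{A})$ by $(afb)(m)=f(bma)$. For $\zeta\in\mathscr{B}^*$, $\xi\in\mathscr{A}^*$, the functional $\zeta\otimes\xi$ on $\mathscr{B}\otimes\mathscr{A}$ is reduced, hence extends to $M(\mathscr{B}\otimes\mathscr{A})$. **Slices.** For $Y\in M(\mathscr{B}\otimes\mathscr{A})$ and $\xi\in\mathscr{A}^*$, the right slice $(\mathrm{id}\otimes\xi)(Y)$ is the unique multiplier $m\in M(\mathscr{B})$ such that $(\zeta\otimes\xi)(Y)=\zeta(m)$ for all $\zeta\in\mathscr{B}^*$ (existence and uniqueness are known). **Discrete quantum groups.** A multiplier Hopf algebra is a pair $(\mathscr{A},\delta)$ with $\mathscr{A}$ an algebra with non degenerate product and $\delta:\mathscr{A}\to M(\mathscr{A}\otimes\mathscr{A})$ a homomorphism such that the maps $T_1:a\otimes b\mapsto\delta(a)(I\otimes b)$ and $T_2:a\otimes b\mapsto(a\otimes I)\delta(b)$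 take values in $\mathscr{A}\otimes\mathscr{A}$, are bijections of $\mathscr{A}\otimes\mathscr{A}$ onto $\mathscr{A}\otimes\mathscr{A}$, and $T_2\otimes\mathrm{id}$ and $\mathrm{id}\otimes T_1$ commute on $\mathscr{A}\otimes\mathscr{A}\otimes\mathscr{A}$. It is a multiplier Hopf $*$-algebra if $\mathscr{A}$ is a $*$-algebra and $\delta$ is a $*$-homomorphism. It is regular if $(\mathscr{A},\delta')$ is also a multiplier Hopf algebra, where $\delta'$ is $\delta$ composed with the extension of the flip $a\otimes b\mapsto b\otimes a$ to $M(\mathscr{A}\otimes\mathscr{A})$; multiplier Hopf $*$-algebras are automatically regular. A discrete quantum group is a multiplier Hopf $*$-algebra $(\mathscr{A},\delta)$ such that $\mathscr{A}$ is a (algebraic) direct sum of a family of full matrix algebras. **The space $\widehat{\mathscr{A}}$.** A functional $\varphi$ on $\mathscr{A}$ is left invariant if $(\mathrm{id}\otimes\varphi)\delta(a)=\varphi(a)I$ for all $a\in\mathscr{A}$, where $(\mathrm{id}\otimes\varphi)\delta(a)\in M(\mathscr{A})$ is the multiplier given by $b\mapsto(\mathrm{id}\otimes\varphi)(\delta(a)(b\otimes I))$ (left multiplication) and $b\mapsto(\mathrm{id}\otimes\varphi)((b\otimes I)\delta(a))$ (right multiplication). A discrete quantum group has a nonzero left invariant functional $\varphi$, unique up to a scalar, and one sets $\widehat{\mathscr{A}}=\{a\varphi:\ a\in\mathscr{A}\}=\{\varphi a:\ a\in\mathscr{A}\}$. It is known that $\widehat{\mathscr{A}}\subset\mathscr{A}^*$,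 so the slices $(\mathrm{id}\otimes\xi)(Y)$ with $\xi\in\widehat{\mathscr{A}}$ are defined. *)

theory Defs
  imports Complex_Main "HOL-Library.Poly_Mapping" "Jordan_Normal_Form.Matrix"
begin

section \<open>Complex vector spaces, algebras and star algebras\<close>

class complex_vector = ab_group_add +
  fixes scaleC :: "complex \<Rightarrow> 'a \<Rightarrow> 'a"  (infixr "*\<^sub>C" 75)
  assumes scaleC_add_right: "c *\<^sub>C (x + y) = c *\<^sub>C x + c *\<^sub>C y"
    and scaleC_add_left: "(c + d) *\<^sub>C x = c *\<^sub>C x + d *\<^sub>C x"
    and scaleC_scaleC: "c *\<^sub>C d *\<^sub>C x = (c * d) *\<^sub>C x"
    and scaleC_one: "1 *\<^sub>C x = x"

global_interpretation cvec: vector_space "scaleC :: complex \<Rightarrow> 'a \<Rightarrow> 'a::complex_vector"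
  by unfold_locales (simp_all add: scaleC_add_right scaleC_add_left scaleC_scaleC scaleC_one)

class complex_algebra = complex_vector + ring +
  assumes mult_scaleC_left: "(c *\<^sub>C x) * y = c *\<^sub>C (x * y)"
    and mult_scaleC_right: "x * (c *\<^sub>C y) = c *\<^sub>C (x * y)"

class complex_star_algebra = complex_algebra +
  fixes star :: "'a \<Rightarrow> 'a"
  assumes star_add: "star (x + y) = star x + star y"
    and star_scaleC: "star (c *\<^sub>C x) = cnj c *\<^sub>C star x"
    and star_mult: "star (x * y) = star y * star x"
    and star_star: "star (star x) = x"

instantiation complex :: complex_algebra
begin
definition "scaleC_complex = ((*) :: complex \<Rightarrow> complex \<Rightarrow> complex)"
instance by standard (simp_all add: scaleC_complex_def algebra_simps)
end

abbreviation clinear :: "('a::complex_vector \<Rightarrow> 'b::complex_vector) \<Rightarrow> bool" where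
  "clinear \<equiv> Vector_Spaces.linear (*\<^sub>C) (*\<^sub>C)"

definition finite_dimensional :: "'a::complex_vector set \<Rightarrow> bool" where
  "finite_dimensional V \<longleftrightarrow> (\<exists>S. finite S \<and> V \<subseteq> cvec.span S)"

definition nondegenerate_product :: "'a::complex_algebra itself \<Rightarrow> bool" where
  "nondegenerate_product _ \<longleftrightarrow>
     (\<forall>a::'a. (\<forall>b. a * b = 0) \<longrightarrow> a = 0) \<and> (\<forall>b::'a. (\<forall>a. a * b = 0) \<longrightarrow> b = 0)"

lemma clinearI:
  assumes "\<And>x y. f (x + y) = f x + f y" and "\<And>c x. f (c *\<^sub>C x) = c *\<^sub>C f x"
  shows "clinear f"
  using assms by unfold_locales auto

lemma clinear_add: "clinear f \<Longrightarrow> f (x + y) = f x + f y"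
  by (simp add: Vector_Spaces.linear_iff)

lemma clinear_scaleC: "clinear f \<Longrightarrow> f (c *\<^sub>C x) = c *\<^sub>C f x"
  by (simp add: Vector_Spaces.linear_iff)

lemma clinear_iff:
  "clinear f \<longleftrightarrow> (\<forall>x y. f (x + y) = f x + f y) \<and> (\<forall>c x. f (c *\<^sub>C x) = c *\<^sub>C f x)"
  by (meson clinearI clinear_add clinear_scaleC)

lemma star_zero [simp]: "star (0::'a::complex_star_algebra) = 0"
  using star_add[of 0 "0::'a"] by simp


section \<open>The algebraic tensor product\<close>

instantiation poly_mapping :: (type, complex_vector) complex_vector
begin
lift_definition scaleC_poly_mapping :: "complex \<Rightarrow> ('a \<Rightarrow>\<^sub>0 'b) \<Rightarrow> 'a \<Rightarrow>\<^sub>0 'b"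
  is "\<lambda>c f x. c *\<^sub>C f x"
  by (erule rev_finite_subset) (auto simp: cvec.scale_zero_right)
instance
  by standard (transfer, simp add: scaleC_add_right scaleC_add_left scaleC_scaleC scaleC_one)+
end

text \<open>The tensor product is the quotient of the free complex vector space on pairs by the
  subspace spanned by the bilinearity relations.\<close>

definition tensor_relations :: "(('b::complex_vector \<times> 'a::complex_vector) \<Rightarrow>\<^sub>0 complex) set" where
  "tensor_relations = cvec.span (
     {Poly_Mapping.single (b + b', a) 1 - Poly_Mapping.single (b, a) 1
        - Poly_Mapping.single (b', a) 1 | b b' a. True} \<union>
     {Poly_Mapping.single (b, a + a') 1 - Poly_Mapping.single (b, a) 1
        - Poly_Mapping.single (b, a') 1 | b a a'. True} \<union>
     {Poly_Mapping.single (c *\<^sub>C b, a) 1 - c *\<^sub>C Poly_Mapping.single (b, a) 1 | c b a. True} \<union>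
     {Poly_Mapping.single (b, c *\<^sub>C a) 1 - c *\<^sub>C Poly_Mapping.single (b, a) 1 | c b a. True})"

quotient_type (overloaded) ('b, 'a) tensor  (infixr "\<otimes>" 70) =
  "('b::complex_vector \<times> 'a::complex_vector) \<Rightarrow>\<^sub>0 complex" / "\<lambda>x y. x - y \<in> tensor_relations"
proof (rule equivpI)
  show "reflp (\<lambda>x y. x - y \<in> (tensor_relations :: (('b \<times> 'a) \<Rightarrow>\<^sub>0 complex) set))"
    by (rule reflpI) (simp add: tensor_relations_def cvec.span_zero)
  show "symp (\<lambda>x y. x - y \<in> (tensor_relations :: (('b \<times> 'a) \<Rightarrow>\<^sub>0 complex) set))"
    by (rule sympI) (use cvec.span_neg minus_diff_eq in \<open>fastforce simp: tensor_relations_def\<close>)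
  show "transp (\<lambda>x y. x - y \<in> (tensor_relations :: (('b \<times> 'a) \<Rightarrow>\<^sub>0 complex) set))"
  proof (rule transpI)
    fix x y z :: "('b \<times> 'a) \<Rightarrow>\<^sub>0 complex"
    assume "x - y \<in> tensor_relations" "y - z \<in> tensor_relations"
    then have "(x - y) + (y - z) \<in> tensor_relations"
      unfolding tensor_relations_def by (rule cvec.span_add)
    then show "x - z \<in> tensor_relations" by simp
  qed
qed

instantiation tensor :: (complex_vector, complex_vector) complex_vector
begin

lift_definition zero_tensor :: "'a \<otimes> 'b" is 0 .

lift_definition plus_tensor :: "'a \<otimes> 'b \<Rightarrow> 'a \<otimes> 'b \<Rightarrow> 'a \<otimes> 'b" is "(+)"
proof -
  fix x y x' y' :: "('a \<times> 'b) \<Rightarrow>\<^sub>0 complex"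
  assume "x - y \<in> tensor_relations" "x' - y' \<in> tensor_relations"
  then have "(x - y) + (x' - y') \<in> tensor_relations"
    unfolding tensor_relations_def by (rule cvec.span_add)
  then show "x + x' - (y + y') \<in> tensor_relations" by (simp only: add_diff_add)
qed

lift_definition minus_tensor :: "'a \<otimes> 'b \<Rightarrow> 'a \<otimes> 'b \<Rightarrow> 'a \<otimes> 'b" is "(-)"
proof -
  fix x y x' y' :: "('a \<times> 'b) \<Rightarrow>\<^sub>0 complex"
  assume "x - y \<in> tensor_relations" "x' - y' \<in> tensor_relations"
  then have "(x - y) - (x' - y') \<in> tensor_relations"
    unfolding tensor_relations_def by (rule cvec.span_diff)
  then show "x - x' - (y - y') \<in> tensor_relations" by (simp add: algebra_simps)
qed

lift_definition uminus_tensor :: "'a \<otimes> 'b \<Rightarrow> 'a \<otimes> 'b" is "uminus"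
proof -
  fix x y :: "('a \<times> 'b) \<Rightarrow>\<^sub>0 complex"
  assume "x - y \<in> tensor_relations"
  then have "- (x - y) \<in> tensor_relations"
    unfolding tensor_relations_def by (rule cvec.span_neg)
  then show "- x - - y \<in> tensor_relations" by simp
qed

lift_definition scaleC_tensor :: "complex \<Rightarrow> 'a \<otimes> 'b \<Rightarrow> 'a \<otimes> 'b" is "scaleC"
  unfolding tensor_relations_def cvec.scale_right_diff_distrib[symmetric] by (rule cvec.span_scale)

instance
  by standard (transfer, simp add: tensor_relations_def cvec.span_zero algebra_simps
      scaleC_add_right scaleC_add_left scaleC_scaleC scaleC_one)+

end

lift_definition tens :: "'b::complex_vector \<Rightarrow> 'a::complex_vector \<Rightarrow> 'b \<otimes> 'a"  (infixr "\<otimes>\<^sub>t" 70)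
  is "\<lambda>b a. Poly_Mapping.single (b, a) 1" .

lemma tens_add_left: "(b + b') \<otimes>\<^sub>t a = b \<otimes>\<^sub>t a + b' \<otimes>\<^sub>t a"
  by transfer (unfold tensor_relations_def diff_diff_add[symmetric], rule cvec.span_base, blast)

lemma tens_add_right: "b \<otimes>\<^sub>t (a + a') = b \<otimes>\<^sub>t a + b \<otimes>\<^sub>t a'"
  by transfer (unfold tensor_relations_def diff_diff_add[symmetric], rule cvec.span_base, blast)

lemma tens_scaleC_left: "(c *\<^sub>C b) \<otimes>\<^sub>t a = c *\<^sub>C (b \<otimes>\<^sub>t a)"
  by transfer (unfold tensor_relations_def, rule cvec.span_base, blast)

lemma tens_scaleC_right: "b \<otimes>\<^sub>t (c *\<^sub>C a) = c *\<^sub>C (b \<otimes>\<^sub>t a)"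
  by transfer (unfold tensor_relations_def, rule cvec.span_base, blast)

lemma tens_zero_left [simp]: "0 \<otimes>\<^sub>t a = 0"
  using tens_add_left[of 0 0 a] by simp

lemma tens_zero_right [simp]: "b \<otimes>\<^sub>t 0 = 0"
  using tens_add_right[of b 0 0] by simp

lemma tensor_induct [case_names tens add]:
  assumes tens: "\<And>b a. P (b \<otimes>\<^sub>t a)" and add: "\<And>s t. P s \<Longrightarrow> P t \<Longrightarrow> P (s + t)"
  shows "P t"
proof -
  have "P (abs_tensor x)" for x :: "('a \<times> 'b) \<Rightarrow>\<^sub>0 complex"
  proof (induction x rule: update_induct)
    case const
    show ?case using tens[of 0 0] by (simp add: zero_tensor_def)
  next
    case (update x p c)
    obtain b a where p: "p = (b, a)" by (cases p)
    have "Poly_Mapping.update p c x = x + Poly_Mapping.single p c"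
      using update(1) by (intro poly_mapping_eqI)
        (auto simp: lookup_update lookup_add lookup_single when_def in_keys_iff)
    moreover have "Poly_Mapping.single p c = c *\<^sub>C Poly_Mapping.single (b, a) (1::complex)"
      unfolding p by transfer (auto simp: scaleC_complex_def when_def)
    ultimately have "abs_tensor (Poly_Mapping.update p c x) = abs_tensor x + c *\<^sub>C (b \<otimes>\<^sub>t a)"
      by (simp only: tens.abs_eq scaleC_tensor.abs_eq plus_tensor.abs_eq)
    also have "\<dots> = abs_tensor x + (c *\<^sub>C b) \<otimes>\<^sub>t a" by (simp only: tens_scaleC_left)
    finally have "abs_tensor (Poly_Mapping.update p c x) = abs_tensor x + (c *\<^sub>C b) \<otimes>\<^sub>t a" .
    then show ?case using update by (simp add: add tens)
  qed
  from this[of "rep_tensor t"] show ?thesis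
    by (simp only: Quotient3_abs_rep[OF Quotient3_tensor])
qed


subsection \<open>The universal property\<close>

text \<open>The parameter \<open>\<kappa>\<close> is the identity for bilinear maps and complex conjugation for
  conjugate-bilinear maps; the latter case serves to define the star of a tensor.\<close>

definition semibilinear ::
  "(complex \<Rightarrow> complex) \<Rightarrow> ('b::complex_vector \<Rightarrow> 'a::complex_vector \<Rightarrow> 'c::complex_vector) \<Rightarrow> bool"
  where "semibilinear \<kappa> \<beta> \<longleftrightarrow>
    (\<forall>b b' a. \<beta> (b + b') a = \<beta> b a + \<beta> b' a) \<and> (\<forall>b a a'. \<beta> b (a + a') = \<beta> b a + \<beta> b a') \<and>
    (\<forall>c b a. \<beta> (c *\<^sub>C b) a = \<kappa> c *\<^sub>C \<beta> b a) \<and> (\<forall>c b a. \<beta> b (c *\<^sub>C a) = \<kappa> c *\<^sub>C \<beta> b a)"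

definition field_endo :: "(complex \<Rightarrow> complex) \<Rightarrow> bool" where
  "field_endo \<kappa> \<longleftrightarrow> \<kappa> 0 = 0 \<and> \<kappa> 1 = 1 \<and> (\<forall>c d. \<kappa> (c + d) = \<kappa> c + \<kappa> d) \<and> (\<forall>c d. \<kappa> (c * d) = \<kappa> c * \<kappa> d)"

definition free_semilift ::
  "(complex \<Rightarrow> complex) \<Rightarrow> ('b \<Rightarrow> 'a \<Rightarrow> 'c) \<Rightarrow>
   (('b::complex_vector \<times> 'a::complex_vector) \<Rightarrow>\<^sub>0 complex) \<Rightarrow> 'c::complex_vector" where
  "free_semilift \<kappa> \<beta> x =
     (\<Sum>p\<in>Poly_Mapping.keys x. \<kappa> (Poly_Mapping.lookup x p) *\<^sub>C \<beta> (fst p) (snd p))"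

definition tensor_semilift ::
  "(complex \<Rightarrow> complex) \<Rightarrow> ('b \<Rightarrow> 'a \<Rightarrow> 'c) \<Rightarrow>
   'b::complex_vector \<otimes> 'a::complex_vector \<Rightarrow> 'c::complex_vector" where
  "tensor_semilift \<kappa> \<beta> t = free_semilift \<kappa> \<beta> (rep_tensor t)"

definition tensor_lift ::
  "('b \<Rightarrow> 'a \<Rightarrow> 'c) \<Rightarrow> 'b::complex_vector \<otimes> 'a::complex_vector \<Rightarrow> 'c::complex_vector" where
  "tensor_lift \<beta> = tensor_semilift (\<lambda>c. c) \<beta>"

lemma field_endo_id [simp]: "field_endo (\<lambda>c. c)" and field_endo_cnj [simp]: "field_endo cnj"
  by (simp_all add: field_endo_def)

lemma free_semilift_superset:
  assumes "field_endo \<kappa>" "finite S" "Poly_Mapping.keys x \<subseteq> S"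
  shows "free_semilift \<kappa> \<beta> x = (\<Sum>p\<in>S. \<kappa> (Poly_Mapping.lookup x p) *\<^sub>C \<beta> (fst p) (snd p))"
  unfolding free_semilift_def using assms
  by (intro sum.mono_neutral_left) (auto simp: field_endo_def in_keys_iff)

lemma free_semilift_add:
  assumes "field_endo \<kappa>"
  shows "free_semilift \<kappa> \<beta> (x + y) = free_semilift \<kappa> \<beta> x + free_semilift \<kappa> \<beta> y"
proof -
  let ?S = "Poly_Mapping.keys x \<union> Poly_Mapping.keys y"
  have "free_semilift \<kappa> \<beta> z = (\<Sum>p\<in>?S. \<kappa> (Poly_Mapping.lookup z p) *\<^sub>C \<beta> (fst p) (snd p))"
    if "Poly_Mapping.keys z \<subseteq> ?S" for z
    by (rule free_semilift_superset) (use assms that in auto)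
  then show ?thesis
    using assms keys_add[of x y]
    by (simp add: lookup_add field_endo_def scaleC_add_left sum.distrib)
qed

lemma free_semilift_scaleC:
  assumes "field_endo \<kappa>"
  shows "free_semilift \<kappa> \<beta> (c *\<^sub>C x) = \<kappa> c *\<^sub>C free_semilift \<kappa> \<beta> x"
proof -
  have lk: "Poly_Mapping.lookup (c *\<^sub>C x) p = c * Poly_Mapping.lookup x p" for p
    by transfer (simp add: scaleC_complex_def)
  then have "Poly_Mapping.keys (c *\<^sub>C x) \<subseteq> Poly_Mapping.keys x"
    by (auto simp: in_keys_iff)
  then have "free_semilift \<kappa> \<beta> (c *\<^sub>C x) =
      (\<Sum>p\<in>Poly_Mapping.keys x. \<kappa> (Poly_Mapping.lookup (c *\<^sub>C x) p) *\<^sub>C \<beta> (fst p) (snd p))"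
    by (intro free_semilift_superset) (use assms in auto)
  also have "\<dots> = \<kappa> c *\<^sub>C free_semilift \<kappa> \<beta> x"
    using assms unfolding free_semilift_def lk
    by (simp add: field_endo_def cvec.scale_sum_right)
  finally show ?thesis .
qed

lemma free_semilift_diff:
  assumes "field_endo \<kappa>"
  shows "free_semilift \<kappa> \<beta> (x - y) = free_semilift \<kappa> \<beta> x - free_semilift \<kappa> \<beta> y"
  using free_semilift_add[OF assms, of \<beta> "x - y" y] by simp

lemma free_semilift_single:
  assumes "field_endo \<kappa>"
  shows "free_semilift \<kappa> \<beta> (Poly_Mapping.single (b, a) 1) = \<beta> b a"
  using assms by (simp add: free_semilift_def field_endo_def scaleC_one)

lemma free_semilift_relations:
  assumes \<kappa>: "field_endo \<kappa>" and \<beta>: "semibilinear \<kappa> \<beta>" and x: "x \<in> tensor_relations"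
  shows "free_semilift \<kappa> \<beta> x = 0"
  using x unfolding tensor_relations_def
proof (rule cvec.span_induct)
  have "free_semilift \<kappa> \<beta> 0 = 0" by (simp add: free_semilift_def)
  then show "cvec.subspace (Collect (\<lambda>x. free_semilift \<kappa> \<beta> x = 0))"
    by (auto intro!: cvec.subspaceI simp: free_semilift_add[OF \<kappa>] free_semilift_scaleC[OF \<kappa>])
qed (use \<beta> in \<open>auto simp: free_semilift_diff[OF \<kappa>] free_semilift_scaleC[OF \<kappa>]
       free_semilift_single[OF \<kappa>] semibilinear_def\<close>)

lemma tensor_semilift_abs:
  assumes \<kappa>: "field_endo \<kappa>" and \<beta>: "semibilinear \<kappa> \<beta>"
  shows "tensor_semilift \<kappa> \<beta> (abs_tensor x) = free_semilift \<kappa> \<beta> x"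
proof -
  have "rep_tensor (abs_tensor x) - x \<in> tensor_relations"
    by (simp only: tensor.abs_eq_iff[symmetric] Quotient3_abs_rep[OF Quotient3_tensor])
  from free_semilift_relations[OF \<kappa> \<beta> this] show ?thesis
    by (simp add: tensor_semilift_def free_semilift_diff[OF \<kappa>])
qed

lemma tensor_semilift_add:
  assumes \<kappa>: "field_endo \<kappa>" and \<beta>: "semibilinear \<kappa> \<beta>"
  shows "tensor_semilift \<kappa> \<beta> (s + t) = tensor_semilift \<kappa> \<beta> s + tensor_semilift \<kappa> \<beta> t"
  by (induction s; induction t)
    (simp add: plus_tensor.abs_eq tensor_semilift_abs[OF \<kappa> \<beta>] free_semilift_add[OF \<kappa>])

lemma tensor_semilift_scaleC:
  assumes \<kappa>: "field_endo \<kappa>" and \<beta>: "semibilinear \<kappa> \<beta>"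
  shows "tensor_semilift \<kappa> \<beta> (c *\<^sub>C t) = \<kappa> c *\<^sub>C tensor_semilift \<kappa> \<beta> t"
  by (induction t)
    (simp add: scaleC_tensor.abs_eq tensor_semilift_abs[OF \<kappa> \<beta>] free_semilift_scaleC[OF \<kappa>])

lemma tensor_semilift_tens:
  assumes \<kappa>: "field_endo \<kappa>" and \<beta>: "semibilinear \<kappa> \<beta>"
  shows "tensor_semilift \<kappa> \<beta> (b \<otimes>\<^sub>t a) = \<beta> b a"
  by (simp add: tens.abs_eq tensor_semilift_abs[OF \<kappa> \<beta>] free_semilift_single[OF \<kappa>])

abbreviation cbilinear where "cbilinear \<equiv> semibilinear (\<lambda>c. c)"

lemma bilinearI:
  assumes "\<And>b b' a. \<beta> (b + b') a = \<beta> b a + \<beta> b' a" and "\<And>b a a'. \<beta> b (a + a') = \<beta> b a + \<beta> b a'"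
    and "\<And>c b a. \<beta> (c *\<^sub>C b) a = c *\<^sub>C \<beta> b a" and "\<And>c b a. \<beta> b (c *\<^sub>C a) = c *\<^sub>C \<beta> b a"
  shows "cbilinear \<beta>"
  using assms by (simp add: semibilinear_def)

lemmas tensor_lift_add = tensor_semilift_add[OF field_endo_id, folded tensor_lift_def]
lemmas tensor_lift_scaleC = tensor_semilift_scaleC[OF field_endo_id, folded tensor_lift_def]
lemmas tensor_lift_tens = tensor_semilift_tens[OF field_endo_id, folded tensor_lift_def]

lemma clinear_tensor_lift: "cbilinear \<beta> \<Longrightarrow> clinear (tensor_lift \<beta>)"
  by (simp add: clinear_iff tensor_lift_add tensor_lift_scaleC)

lemma bilinear_tens: "cbilinear (\<otimes>\<^sub>t)"
  by (simp add: semibilinear_def tens_add_left tens_add_right tens_scaleC_left tens_scaleC_right)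


subsection \<open>Derived maps\<close>

definition tensor_map ::
  "('b::complex_vector \<Rightarrow> 'd::complex_vector) \<Rightarrow> ('a::complex_vector \<Rightarrow> 'c::complex_vector) \<Rightarrow>
   'b \<otimes> 'a \<Rightarrow> 'd \<otimes> 'c" where
  "tensor_map f g = tensor_lift (\<lambda>b a. f b \<otimes>\<^sub>t g a)"

definition tensor_functional ::
  "('b::complex_vector \<Rightarrow> complex) \<Rightarrow> ('a::complex_vector \<Rightarrow> complex) \<Rightarrow> 'b \<otimes> 'a \<Rightarrow> complex" where
  "tensor_functional f g = tensor_lift (\<lambda>b a. f b * g a)"

definition id_tensor_functional ::
  "('a::complex_vector \<Rightarrow> complex) \<Rightarrow> 'b::complex_vector \<otimes> 'a \<Rightarrow> 'b" where
  "id_tensor_functional g = tensor_lift (\<lambda>b a. g a *\<^sub>C b)"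

definition tensor_assoc ::
  "('a::complex_vector \<otimes> 'b::complex_vector) \<otimes> 'c::complex_vector \<Rightarrow> 'a \<otimes> ('b \<otimes> 'c)" where
  "tensor_assoc = tensor_lift (\<lambda>t c. tensor_lift (\<lambda>a b. a \<otimes>\<^sub>t (b \<otimes>\<^sub>t c)) t)"

definition tensor_assoc_inv ::
  "'a::complex_vector \<otimes> ('b::complex_vector \<otimes> 'c::complex_vector) \<Rightarrow> ('a \<otimes> 'b) \<otimes> 'c" where
  "tensor_assoc_inv = tensor_lift (\<lambda>a t. tensor_lift (\<lambda>b c. (a \<otimes>\<^sub>t b) \<otimes>\<^sub>t c) t)"

lemma bilinear_tensor_map: "clinear f \<Longrightarrow> clinear g \<Longrightarrow> cbilinear (\<lambda>b a. f b \<otimes>\<^sub>t g a)"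
  by (intro bilinearI)
    (simp_all add: clinear_add clinear_scaleC tens_add_left tens_add_right
      tens_scaleC_left tens_scaleC_right)

lemma tensor_map_tens: "clinear f \<Longrightarrow> clinear g \<Longrightarrow> tensor_map f g (b \<otimes>\<^sub>t a) = f b \<otimes>\<^sub>t g a"
  by (simp add: tensor_map_def tensor_lift_tens bilinear_tensor_map)

lemma clinear_tensor_map: "clinear f \<Longrightarrow> clinear g \<Longrightarrow> clinear (tensor_map f g)"
  unfolding tensor_map_def by (intro clinear_tensor_lift bilinear_tensor_map)

lemma bilinear_lift_left:
  assumes "\<And>c. cbilinear (\<lambda>a b. \<beta> a b c)" and "\<And>a b. clinear (\<beta> a b)"
  shows "cbilinear (\<lambda>t c. tensor_lift (\<lambda>a b. \<beta> a b c) t)"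
proof (rule bilinearI)
  fix t c c'
  show "tensor_lift (\<lambda>a b. \<beta> a b (c + c')) t =
      tensor_lift (\<lambda>a b. \<beta> a b c) t + tensor_lift (\<lambda>a b. \<beta> a b c') t"
    by (induction t rule: tensor_induct)
      (simp_all only: tensor_lift_tens[OF assms(1)] tensor_lift_add[OF assms(1)],
        simp_all add: clinear_add[OF assms(2)] ac_simps)
next
  fix k t c
  show "tensor_lift (\<lambda>a b. \<beta> a b (k *\<^sub>C c)) t = k *\<^sub>C tensor_lift (\<lambda>a b. \<beta> a b c) t"
    by (induction t rule: tensor_induct)
      (simp_all only: tensor_lift_tens[OF assms(1)] tensor_lift_add[OF assms(1)],
        simp_all add: clinear_scaleC[OF assms(2)] scaleC_add_right)
qed (simp_all add: tensor_lift_add tensor_lift_scaleC assms)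

lemma bilinear_flip: "cbilinear \<beta> \<Longrightarrow> cbilinear (\<lambda>a b. \<beta> b a)"
  by (simp add: semibilinear_def)

lemma tensor_assoc_tens: "tensor_assoc ((a \<otimes>\<^sub>t b) \<otimes>\<^sub>t c) = a \<otimes>\<^sub>t (b \<otimes>\<^sub>t c)"
proof -
  have 1: "cbilinear (\<lambda>a b. a \<otimes>\<^sub>t (b \<otimes>\<^sub>t c))" for c :: 'c
    by (intro bilinearI) (simp_all add: tens_add_left tens_add_right tens_scaleC_left tens_scaleC_right)
  have 2: "clinear (\<lambda>c. a \<otimes>\<^sub>t (b \<otimes>\<^sub>t c))" for a :: 'a and b :: 'b
    by (intro clinearI) (simp_all add: tens_add_right tens_scaleC_right)
  show ?thesis
    unfolding tensor_assoc_def by (simp add: tensor_lift_tens bilinear_lift_left 1 2)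
qed

lemma tensor_assoc_inv_tens: "tensor_assoc_inv (a \<otimes>\<^sub>t (b \<otimes>\<^sub>t c)) = (a \<otimes>\<^sub>t b) \<otimes>\<^sub>t c"
proof -
  have 1: "cbilinear (\<lambda>b c. (a \<otimes>\<^sub>t b) \<otimes>\<^sub>t c)" for a :: 'a
    by (intro bilinearI) (simp_all add: tens_add_left tens_add_right tens_scaleC_left tens_scaleC_right)
  have 2: "clinear (\<lambda>a. (a \<otimes>\<^sub>t b) \<otimes>\<^sub>t c)" for b :: 'b and c :: 'c
    by (intro clinearI) (simp_all add: tens_add_left tens_scaleC_left)
  show ?thesis
    unfolding tensor_assoc_inv_def
    by (simp add: tensor_lift_tens 1 bilinear_flip[OF bilinear_lift_left[OF 1 2]])
qed


subsection \<open>The tensor product of algebras\<close>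

instantiation tensor :: (complex_algebra, complex_algebra) complex_algebra
begin

definition times_tensor :: "'a \<otimes> 'b \<Rightarrow> 'a \<otimes> 'b \<Rightarrow> 'a \<otimes> 'b" where
  "s * t = tensor_lift (\<lambda>a b. tensor_lift (\<lambda>a' b'. (a * a') \<otimes>\<^sub>t (b * b')) t) s"

lemma bilinear_times_tensor:
  shows "cbilinear ((*) :: 'a \<otimes> 'b \<Rightarrow> _)"
    and tens_times_tens: "((a::'a) \<otimes>\<^sub>t (b::'b)) * (a' \<otimes>\<^sub>t b') = (a * a') \<otimes>\<^sub>t (b * b')"
proof -
  have 1: "cbilinear (\<lambda>a' b'. (a * a') \<otimes>\<^sub>t (b * b'))" for a :: 'a and b :: 'b
    by (intro bilinearI) (simp_all add: distrib_left mult_scaleC_right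
        tens_add_left tens_add_right tens_scaleC_left tens_scaleC_right)
  have 2: "cbilinear (\<lambda>a b. tensor_lift (\<lambda>a' b'. (a * a') \<otimes>\<^sub>t (b * b')) t)" for t :: "'a \<otimes> 'b"
  proof (induction t rule: tensor_induct)
    case (tens a' b')
    show ?case
      by (intro bilinearI) (simp_all only: tensor_lift_tens[OF 1], simp_all add: distrib_right mult_scaleC_left
        tens_add_left tens_add_right tens_scaleC_left tens_scaleC_right)
  next
    case (add s t)
    then show ?case
      by (simp add: tensor_lift_add[OF 1] semibilinear_def scaleC_add_right algebra_simps)
  qed
  have 3: "clinear (\<lambda>t. tensor_lift (\<lambda>a' b'. (a * a') \<otimes>\<^sub>t (b * b')) t)" for a :: 'a and b :: 'b
    by (rule clinear_tensor_lift[OF 1])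
  show "cbilinear ((*) :: 'a \<otimes> 'b \<Rightarrow> _)"
    unfolding times_tensor_def[abs_def] by (rule bilinear_lift_left[OF 2 3])
  show "(a \<otimes>\<^sub>t b) * (a' \<otimes>\<^sub>t b') = (a * a') \<otimes>\<^sub>t (b * b')"
    by (simp only: times_tensor_def tensor_lift_tens[OF 2]) (simp only: tensor_lift_tens[OF 1])
qed

instance
proof
  fix x y z :: "'a \<otimes> 'b" and c :: complex
  have bil: "cbilinear ((*) :: 'a \<otimes> 'b \<Rightarrow> _)" by (rule bilinear_times_tensor)
  show dl: "(x + y) * z = x * z + y * z" for x y z :: "'a \<otimes> 'b"
    using bil by (simp add: semibilinear_def)
  show dr: "x * (y + z) = x * y + x * z" for x y z :: "'a \<otimes> 'b"
    using bil by (simp add: semibilinear_def)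
  show "(c *\<^sub>C x) * y = c *\<^sub>C (x * y)" "x * (c *\<^sub>C y) = c *\<^sub>C (x * y)"
    using bil by (simp_all add: semibilinear_def)
  show "x * y * z = x * (y * z)"
  proof (induction x rule: tensor_induct)
    case (tens a b)
    show ?case
    proof (induction y rule: tensor_induct)
      case (tens a' b')
      show ?case
        by (induction z rule: tensor_induct) (simp_all add: dl dr tens_times_tens mult.assoc)
    qed (simp add: dl dr)
  qed (simp add: dl dr)
qed

end

instantiation tensor :: (complex_star_algebra, complex_star_algebra) complex_star_algebra
begin

definition star_tensor :: "'a \<otimes> 'b \<Rightarrow> 'a \<otimes> 'b" where
  "star_tensor = tensor_semilift cnj (\<lambda>a b. star a \<otimes>\<^sub>t star b)"

lemma semibilinear_star: "semibilinear cnj (\<lambda>(a::'a) (b::'b). star a \<otimes>\<^sub>t star b)"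
  by (simp add: semibilinear_def star_add star_scaleC tens_add_left tens_add_right
      tens_scaleC_left tens_scaleC_right)

lemma star_tens: "star ((a::'a) \<otimes>\<^sub>t (b::'b)) = star a \<otimes>\<^sub>t star b"
  by (simp add: star_tensor_def tensor_semilift_tens semibilinear_star)

instance
proof
  fix x y :: "'a \<otimes> 'b" and c :: complex
  show sa: "star (x + y) = star x + star y" for x y :: "'a \<otimes> 'b"
    by (simp add: star_tensor_def tensor_semilift_add semibilinear_star)
  show "star (c *\<^sub>C x) = cnj c *\<^sub>C star x"
    by (simp add: star_tensor_def tensor_semilift_scaleC semibilinear_star)
  show "star (x * y) = star y * star x"
  proof (induction x rule: tensor_induct)
    case (tens a b)
    show ?case
      by (induction y rule: tensor_induct)
        (simp_all add: sa tens_times_tens star_tens star_mult distrib_left distrib_right)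
  qed (simp add: sa distrib_left distrib_right)
  show "star (star x) = x"
    by (induction x rule: tensor_induct) (simp_all add: sa star_tens star_star)
qed

end


section \<open>Multipliers\<close>

typedef (overloaded) 'a multiplier =
  "{(l, r) | l r :: 'a::complex_algebra \<Rightarrow> 'a. clinear l \<and> clinear r \<and> (\<forall>a b. r a * b = a * l b)}"
  morphisms centralizer_pair Abs_multiplier
  by (intro exI[of _ "(\<lambda>_. 0, \<lambda>_. 0)"]) (auto intro!: clinearI)

setup_lifting type_definition_multiplier

text \<open>For a multiplier \<open>m\<close>, \<open>m \<rhd> a\<close> is the product \<open>m a\<close> and \<open>a \<lhd> m\<close> is the product \<open>a m\<close>.\<close>

lift_definition mult_left :: "'a::complex_algebra multiplier \<Rightarrow> 'a \<Rightarrow> 'a"  (infixr "\<rhd>" 72) is fst .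
lift_definition mult_right :: "'a::complex_algebra multiplier \<Rightarrow> 'a \<Rightarrow> 'a" is snd .
abbreviation mult_right_flip :: "'a::complex_algebra \<Rightarrow> 'a multiplier \<Rightarrow> 'a"  (infixl "\<lhd>" 73) where
  "a \<lhd> m \<equiv> mult_right m a"

lemma clinear_mult_left: "clinear (mult_left m)"
  by transfer auto

lemma clinear_mult_right: "clinear (mult_right m)"
  by transfer auto

lemma multiplier_balanced: "(a \<lhd> m) * b = a * (m \<rhd> b)"
  by transfer auto

lemma multiplier_eqI:
  "(\<And>a. m \<rhd> a = n \<rhd> a) \<Longrightarrow> (\<And>a. a \<lhd> m = a \<lhd> n) \<Longrightarrow> m = n"
  by transfer (auto simp: fun_eq_iff)

instantiation multiplier :: (complex_algebra) complex_algebra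
begin

lift_definition zero_multiplier :: "'a multiplier" is "(\<lambda>_. 0, \<lambda>_. 0)"
  by (auto intro!: clinearI)

lift_definition plus_multiplier :: "'a multiplier \<Rightarrow> 'a multiplier \<Rightarrow> 'a multiplier"
  is "\<lambda>(l, r) (l', r'). (\<lambda>a. l a + l' a, \<lambda>a. r a + r' a)"
  by (auto simp: clinear_iff algebra_simps scaleC_add_right)

lift_definition minus_multiplier :: "'a multiplier \<Rightarrow> 'a multiplier \<Rightarrow> 'a multiplier"
  is "\<lambda>(l, r) (l', r'). (\<lambda>a. l a - l' a, \<lambda>a. r a - r' a)"
  by (auto simp: clinear_iff algebra_simps cvec.scale_right_diff_distrib)

lift_definition uminus_multiplier :: "'a multiplier \<Rightarrow> 'a multiplier"
  is "\<lambda>(l, r). (\<lambda>a. - l a, \<lambda>a. - r a)"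
  by (auto simp: clinear_iff)

lift_definition scaleC_multiplier :: "complex \<Rightarrow> 'a multiplier \<Rightarrow> 'a multiplier"
  is "\<lambda>c (l, r). (\<lambda>a. c *\<^sub>C l a, \<lambda>a. c *\<^sub>C r a)"
  by (auto simp: clinear_iff scaleC_add_right scaleC_scaleC mult.commute
      mult_scaleC_left mult_scaleC_right)

lift_definition times_multiplier :: "'a multiplier \<Rightarrow> 'a multiplier \<Rightarrow> 'a multiplier"
  is "\<lambda>(l, r) (l', r'). (\<lambda>a. l (l' a), \<lambda>a. r' (r a))"
  by (auto simp: clinear_iff)

instance
  by standard (transfer, auto simp: algebra_simps clinear_iff
      scaleC_add_right scaleC_add_left scaleC_scaleC scaleC_one)+

end

instantiation multiplier :: (complex_algebra) one
begin
lift_definition one_multiplier :: "'a multiplier" is "(\<lambda>a. a, \<lambda>a. a)"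
  by (auto intro!: clinearI)
instance ..
end

instance multiplier :: (complex_algebra) monoid_mult
  by standard (transfer, auto)+

instantiation multiplier :: (complex_star_algebra) complex_star_algebra
begin

lift_definition star_multiplier :: "'a multiplier \<Rightarrow> 'a multiplier"
  is "\<lambda>(l, r). (\<lambda>a. star (r (star a)), \<lambda>a. star (l (star a)))"
proof clarsimp
  fix l r :: "'a \<Rightarrow> 'a"
  assume l: "clinear l" and r: "clinear r" and bal: "\<forall>a b. r a * b = a * l b"
  have "star (l (star a)) * b = a * star (r (star b))" for a b
  proof -
    have "star (l (star a)) * b = star (star b * l (star a))" by (simp add: star_mult star_star)
    also have "\<dots> = star (r (star b) * star a)" using bal by simp
    finally show ?thesis by (simp add: star_mult star_star)
  qed
  then show "clinear (\<lambda>a. star (r (star a))) \<and> clinear (\<lambda>a. star (l (star a))) \<and>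
      (\<forall>a b. star (l (star a)) * b = a * star (r (star b)))"
    using l r by (auto simp: clinear_iff star_add star_scaleC)
qed

instance
  by standard (transfer, auto simp: star_add star_scaleC star_star clinear_iff)+

end

text \<open>The map of an algebra into its multiplier algebra; it is injective when the product is
  non degenerate.\<close>

lift_definition of_alg :: "'a::complex_algebra \<Rightarrow> 'a multiplier"
  is "\<lambda>a. (\<lambda>b. a * b, \<lambda>b. b * a)"
  by (auto intro!: clinearI simp: distrib_left distrib_right mult_scaleC_left mult_scaleC_right mult.assoc)

lift_definition multiplier_tens ::
  "'b::complex_algebra multiplier \<Rightarrow> 'a::complex_algebra multiplier \<Rightarrow> ('b \<otimes> 'a) multiplier"
  is "\<lambda>(l, r) (l', r'). (tensor_map l l', tensor_map r r')"
proof clarsimp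
  fix l r :: "'b \<Rightarrow> 'b" and l' r' :: "'a \<Rightarrow> 'a"
  assume lin: "clinear l" "clinear r" "clinear l'" "clinear r'"
    and bal: "\<forall>a b. r a * b = a * l b" "\<forall>a b. r' a * b = a * l' b"
  have "tensor_map r r' s * t = s * tensor_map l l' t" for s t
  proof (induction s rule: tensor_induct)
    case (tens b a)
    show ?case
      by (induction t rule: tensor_induct)
        (use lin bal in \<open>simp_all add: tensor_map_tens tens_times_tens distrib_left
          clinear_add[OF clinear_tensor_map]\<close>)
  qed (use lin in \<open>simp add: distrib_right clinear_add[OF clinear_tensor_map]\<close>)
  then show "clinear (tensor_map l l') \<and> clinear (tensor_map r r') \<and>
      (\<forall>a b. tensor_map r r' a * b = a * tensor_map l l' b)"
    using lin by (simp add: clinear_tensor_map)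
qed

definition multiplier_embed ::
  "'b::complex_algebra multiplier \<otimes> 'a::complex_algebra multiplier \<Rightarrow> ('b \<otimes> 'a) multiplier" where
  "multiplier_embed = tensor_lift multiplier_tens"

lemma mult_left_multiplier_tens: "mult_left (multiplier_tens m n) = tensor_map (mult_left m) (mult_left n)"
  and mult_right_multiplier_tens: "mult_right (multiplier_tens m n) = tensor_map (mult_right m) (mult_right n)"
  by (auto simp: mult_left.rep_eq mult_right.rep_eq multiplier_tens.rep_eq fun_eq_iff split: prod.split)

lemma multiplier_tens_left_tens: "multiplier_tens m n \<rhd> (b \<otimes>\<^sub>t a) = (m \<rhd> b) \<otimes>\<^sub>t (n \<rhd> a)"
  by (simp add: mult_left_multiplier_tens tensor_map_tens clinear_mult_left)

lemma multiplier_tens_right_tens: "(b \<otimes>\<^sub>t a) \<lhd> multiplier_tens m n = (b \<lhd> m) \<otimes>\<^sub>t (a \<lhd> n)"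
  by (simp add: mult_right_multiplier_tens tensor_map_tens clinear_mult_right)

lemma mult_left_add: "(m + n) \<rhd> a = m \<rhd> a + n \<rhd> a"
  and mult_right_add: "a \<lhd> (m + n) = a \<lhd> m + a \<lhd> n"
  and mult_left_scaleC: "(c *\<^sub>C m) \<rhd> a = c *\<^sub>C (m \<rhd> a)"
  and mult_right_scaleC: "a \<lhd> (c *\<^sub>C m) = c *\<^sub>C (a \<lhd> m)"
  by (transfer, auto)+

lemma bilinear_multiplier_tens:
  "cbilinear (multiplier_tens :: 'b::complex_algebra multiplier \<Rightarrow> 'a::complex_algebra multiplier \<Rightarrow> _)"
proof -
  have eqI: "m = n" if "\<And>b a. m \<rhd> (b \<otimes>\<^sub>t a) = n \<rhd> (b \<otimes>\<^sub>t a)" "\<And>b a. (b \<otimes>\<^sub>t a) \<lhd> m = (b \<otimes>\<^sub>t a) \<lhd> n"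
    for m n :: "('b \<otimes> 'a) multiplier"
  proof (rule multiplier_eqI)
    fix t
    show "m \<rhd> t = n \<rhd> t"
      by (induction t rule: tensor_induct) (simp_all add: that clinear_add[OF clinear_mult_left])
    show "t \<lhd> m = t \<lhd> n"
      by (induction t rule: tensor_induct) (simp_all add: that clinear_add[OF clinear_mult_right])
  qed
  show ?thesis
    by (intro bilinearI eqI)
      (simp_all add: multiplier_tens_left_tens multiplier_tens_right_tens mult_left_add
        mult_right_add mult_left_scaleC mult_right_scaleC tens_add_left tens_add_right
        tens_scaleC_left tens_scaleC_right)
qed

lemma multiplier_embed_tens: "multiplier_embed (m \<otimes>\<^sub>t n) = multiplier_tens m n"
  by (simp add: multiplier_embed_def tensor_lift_tens bilinear_multiplier_tens)


section \<open>Reduced functionals and slices\<close>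

text \<open>A list of triples \<open>(a, f, b)\<close> presents the functional \<open>\<Sum> a f b\<close>, where
  \<open>(a f b)(c) = f (b c a)\<close>. The span of all \<open>a f b\<close> is the set of these finite sums, since
  scalars can be absorbed into \<open>f\<close>.\<close>

type_synonym 'a presentation = "('a \<times> ('a \<Rightarrow> complex) \<times> 'a) list"

definition is_presentation :: "'a::complex_algebra presentation \<Rightarrow> bool" where
  "is_presentation p \<longleftrightarrow> (\<forall>(a, f, b) \<in> set p. clinear f)"

definition presented :: "'a::complex_algebra presentation \<Rightarrow> 'a \<Rightarrow> complex" where
  "presented p c = (\<Sum>(a, f, b) \<leftarrow> p. f (b * c * a))"

definition reduced_functionals :: "('a::complex_algebra \<Rightarrow> complex) set" where
  "reduced_functionals = presented ` {p. is_presentation p}"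

definition extension :: "'a::complex_algebra presentation \<Rightarrow> 'a multiplier \<Rightarrow> complex" where
  "extension p m = (\<Sum>(a, f, b) \<leftarrow> p. f (b * (m \<rhd> a)))"

definition tensor_presentation ::
  "'b::complex_algebra presentation \<Rightarrow> 'a::complex_algebra presentation \<Rightarrow> ('b \<otimes> 'a) presentation"
  where "tensor_presentation q p =
    [(b \<otimes>\<^sub>t a, tensor_functional f g, b' \<otimes>\<^sub>t a'). (b, f, b') \<leftarrow> q, (a, g, a') \<leftarrow> p]"

text \<open>The value of the extension to multipliers may depend on the presentation and not only on
  the presented functional if the product is merely non degenerate: in the algebra of complex
  polynomials without constant term, whose multipliers include the constants, the functional
  \<open>x f x\<close> with \<open>f(p)\<close> the coefficient of \<open>x\<^sup>2\<close> is zero but extends to \<open>I \<mapsto> 1\<close>.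
  The defining equation \<open>(\<zeta> \<otimes> \<xi>)(Y) = \<zeta>(m)\<close> of the slice is therefore required for all
  presentations \<open>q\<close> of a reduced \<open>\<zeta>\<close> and \<open>p\<close> of \<open>\<xi>\<close>, the extension of \<open>\<zeta> \<otimes> \<xi>\<close> being evaluated
  on the presentation induced by \<open>q\<close> and \<open>p\<close>.\<close>

definition is_slice ::
  "('b::complex_algebra \<otimes> 'a::complex_algebra) multiplier \<Rightarrow> ('a \<Rightarrow> complex) \<Rightarrow> 'b multiplier \<Rightarrow> bool"
  where "is_slice Y \<xi> m \<longleftrightarrow> \<xi> \<in> reduced_functionals \<and>
    (\<forall>q p. is_presentation q \<longrightarrow> is_presentation p \<longrightarrow> presented p = \<xi> \<longrightarrow>
       extension (tensor_presentation q p) Y = extension q m)"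

definition slice ::
  "('b::complex_algebra \<otimes> 'a::complex_algebra) multiplier \<Rightarrow> ('a \<Rightarrow> complex) \<Rightarrow> 'b multiplier" where
  "slice Y \<xi> = (THE m. is_slice Y \<xi> m)"


section \<open>Discrete quantum groups\<close>

text \<open>The maps \<open>T\<^sub>1\<close> and \<open>T\<^sub>2\<close> are linear maps of \<open>\<A> \<otimes> \<A>\<close> into itself that agree with
  \<open>a \<otimes> b \<mapsto> \<delta>(a)(I \<otimes> b)\<close> and \<open>a \<otimes> b \<mapsto> (a \<otimes> I)\<delta>(b)\<close> in the multiplier algebra.\<close>

definition multiplier_hopf_algebra ::
  "('a::complex_algebra \<Rightarrow> ('a \<otimes> 'a) multiplier) \<Rightarrow> bool" where
  "multiplier_hopf_algebra \<delta> \<longleftrightarrow>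
     nondegenerate_product TYPE('a) \<and>
     clinear \<delta> \<and> (\<forall>a b. \<delta> (a * b) = \<delta> a * \<delta> b) \<and>
     (\<exists>T\<^sub>1 T\<^sub>2 :: 'a \<otimes> 'a \<Rightarrow> 'a \<otimes> 'a.
        clinear T\<^sub>1 \<and> (\<forall>a b. of_alg (T\<^sub>1 (a \<otimes>\<^sub>t b)) = \<delta> a * multiplier_tens 1 (of_alg b)) \<and>
        clinear T\<^sub>2 \<and> (\<forall>a b. of_alg (T\<^sub>2 (a \<otimes>\<^sub>t b)) = multiplier_tens (of_alg a) 1 * \<delta> b) \<and>
        bij T\<^sub>1 \<and> bij T\<^sub>2 \<and>
        tensor_map T\<^sub>2 id \<circ> (tensor_assoc_inv \<circ> tensor_map id T\<^sub>1 \<circ> tensor_assoc) =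
        (tensor_assoc_inv \<circ> tensor_map id T\<^sub>1 \<circ> tensor_assoc) \<circ> tensor_map T\<^sub>2 id)"

definition multiplier_hopf_star_algebra ::
  "('a::complex_star_algebra \<Rightarrow> ('a \<otimes> 'a) multiplier) \<Rightarrow> bool" where
  "multiplier_hopf_star_algebra \<delta> \<longleftrightarrow>
     multiplier_hopf_algebra \<delta> \<and> (\<forall>a. \<delta> (star a) = star (\<delta> a))"

definition matrix_direct_sum :: "'i set \<Rightarrow> ('i \<Rightarrow> nat) \<Rightarrow> ('i \<Rightarrow> complex mat) set" where
  "matrix_direct_sum J n =
     {x \<in> (\<Pi>\<^sub>E i\<in>J. carrier_mat (n i) (n i)). finite {i \<in> J. x i \<noteq> 0\<^sub>m (n i) (n i)}}"

text \<open>Taking the index set inside \<open>'a\<close> is no restriction: a summand of positive size is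
  determined by its unit, which is an element of the algebra. The isomorphism \<open>\<Phi>\<close> is one of
  algebras; it is not assumed to respect the star.\<close>

definition direct_sum_of_matrix_algebras :: "'a::complex_algebra itself \<Rightarrow> bool" where
  "direct_sum_of_matrix_algebras _ \<longleftrightarrow>
     (\<exists>(J :: 'a set) n (\<Phi> :: 'a \<Rightarrow> 'a \<Rightarrow> complex mat).
        (\<forall>i\<in>J. n i > 0) \<and> bij_betw \<Phi> UNIV (matrix_direct_sum J n) \<and>
        (\<forall>x y. \<forall>i\<in>J. \<Phi> (x + y) i = \<Phi> x i + \<Phi> y i) \<and>
        (\<forall>c x. \<forall>i\<in>J. \<Phi> (c *\<^sub>C x) i = c \<cdot>\<^sub>m \<Phi> x i) \<and>
        (\<forall>x y. \<forall>i\<in>J. \<Phi> (x * y) i = \<Phi> x i * \<Phi> y i))"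

definition discrete_quantum_group ::
  "('a::complex_star_algebra \<Rightarrow> ('a \<otimes> 'a) multiplier) \<Rightarrow> bool" where
  "discrete_quantum_group \<delta> \<longleftrightarrow>
     multiplier_hopf_star_algebra \<delta> \<and> direct_sum_of_matrix_algebras TYPE('a)"

text \<open>\<open>m\<close> is the multiplier \<open>(id \<otimes> \<phi>)(X)\<close> for a functional \<open>\<phi>\<close> that need not be reduced and a
  multiplier \<open>X\<close> such that \<open>X(b \<otimes> I)\<close> and \<open>(b \<otimes> I)X\<close> lie in \<open>\<A> \<otimes> \<A>\<close> for all \<open>b\<close>.\<close>

definition is_partial_evaluation ::
  "('a::complex_algebra \<Rightarrow> complex) \<Rightarrow> ('a \<otimes> 'a) multiplier \<Rightarrow> 'a multiplier \<Rightarrow> bool" where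
  "is_partial_evaluation \<phi> X m \<longleftrightarrow>
     (\<forall>b. \<exists>t. of_alg t = X * multiplier_tens (of_alg b) 1 \<and> m \<rhd> b = id_tensor_functional \<phi> t) \<and>
     (\<forall>b. \<exists>t. of_alg t = multiplier_tens (of_alg b) 1 * X \<and> b \<lhd> m = id_tensor_functional \<phi> t)"

definition left_invariant ::
  "('a::complex_algebra \<Rightarrow> ('a \<otimes> 'a) multiplier) \<Rightarrow> ('a \<Rightarrow> complex) \<Rightarrow> bool" where
  "left_invariant \<delta> \<phi> \<longleftrightarrow>
     clinear \<phi> \<and> (\<forall>a. is_partial_evaluation \<phi> (\<delta> a) (\<phi> a *\<^sub>C 1))"

text \<open>The space of all functionals \<open>a \<phi>\<close>, where \<open>(a \<phi>)(b) = \<phi> (b a)\<close>.\<close>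

definition dual_space :: "('a::complex_algebra \<Rightarrow> complex) \<Rightarrow> ('a \<Rightarrow> complex) set" where
  "dual_space \<phi> = {\<lambda>b. \<phi> (b * a) | a. True}"

end

theory Submission
  imports Defs
begin

text \<open>A slice of \<open>\<Sum> m\<^sub>i \<otimes> n\<^sub>i\<close> is a combination of the \<open>m\<^sub>i\<close>, which gives one implication.

  For the converse, the functionals \<open>a\<phi>\<close> must be shown to exhaust the reduced functionals
  (\<open>dual_space_eq_reduced\<close>). In a direct sum of matrix algebras the reduced functionals are those
  that live on finitely many blocks, so a dimension count reduces this to faithfulness of \<open>\<phi>\<close>:
  \<open>\<phi>(ba) = 0\<close> for all \<open>b\<close> implies \<open>a = 0\<close> (\<open>left_invariant_faithful\<close>). Let \<open>N\<close> be the left ideal of all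
  such \<open>a\<close>. Left invariance and surjectivity of \<open>T\<^sub>2\<close> give \<open>(\<A> \<otimes> \<A>)\<delta>(N) \<subseteq> \<A> \<otimes> N\<close>. Since \<open>\<phi> \<noteq> 0\<close> is given on each
  block by the trace against a matrix, some \<open>y \<noteq> 0\<close> satisfies \<open>N y = 0\<close> (\<open>kernel_ideal_annihilated\<close>). Hence
  \<open>T\<^sub>1(a \<otimes> y) = \<delta>(a)(I \<otimes> y) = 0\<close> for \<open>a \<in> N\<close>, and injectivity of \<open>T\<^sub>1\<close> gives \<open>a = 0\<close>. Neither the counit nor
  the antipode is needed.

  Now let the slices of \<open>Y\<close> by reduced functionals span a space with finite basis \<open>m\<^sub>1, \<dots>, m\<^sub>k\<close>, and write
  \<open>(id \<otimes> \<xi>)(Y) = \<Sum> c\<^sub>i(\<xi>) m\<^sub>i\<close>. Each \<open>c\<^sub>i\<close> is a linear form on the reduced functionals, hence evaluation at a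
  multiplier \<open>n\<^sub>i\<close> of \<open>\<A>\<close> because the blocks are finite dimensional (\<open>multiplier_of_form\<close>). The
  multipliers \<open>Y\<close> and \<open>\<Sum> m\<^sub>i \<otimes> n\<^sub>i\<close> have the same slices and therefore coincide.\<close>

section \<open>Linear functionals and slices of tensors\<close>

lemma scaleC_complex: "c *\<^sub>C (d::complex) = c * d"
  by (simp add: scaleC_complex_def)

lemma clinear_zero: "clinear f \<Longrightarrow> f 0 = 0"
  using clinear_add[of f 0 0] by simp

lemma clinear_diff: "clinear f \<Longrightarrow> f (x - y) = f x - f y"
  using clinear_add[of f "x - y" y] by simp

lemma clinear_sum: "clinear f \<Longrightarrow> f (\<Sum>i\<in>I. x i) = (\<Sum>i\<in>I. f (x i))"
  by (induction I rule: infinite_finite_induct) (auto simp: clinear_zero clinear_add)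

lemma clinear_compose: "clinear f \<Longrightarrow> clinear g \<Longrightarrow> clinear (\<lambda>x. f (g x))"
  by (auto simp: clinear_iff)

lemma clinear_id: "clinear id"
  by (auto simp: clinear_iff)

lemma clinear_times_left: "clinear (\<lambda>x. (a::'a::complex_algebra) * x)"
  and clinear_times_right: "clinear (\<lambda>x. x * (a::'a::complex_algebra))"
  by (auto simp: clinear_iff distrib_left distrib_right mult_scaleC_left mult_scaleC_right)

lemma functionals_separate:
  fixes x :: "'a::complex_vector"
  assumes "x \<noteq> 0"
  obtains g :: "'a \<Rightarrow> complex" where "clinear g" "g x \<noteq> 0"
proof -
  have "cvec.independent {x}" using assms by simp
  then obtain B where B: "{x} \<subseteq> B" "cvec.independent B" "UNIV \<subseteq> cvec.span B"
    using cvec.maximal_independent_subset_extend[of "{x}" UNIV] by auto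
  let ?g = "\<lambda>v. cvec.representation B v x"
  have "clinear ?g"
    using B by (intro clinearI)
      (auto simp: cvec.representation_add cvec.representation_scale scaleC_complex top.extremum_unique)
  moreover have "?g x \<noteq> 0" using cvec.representation_basis[OF B(2), of x] B(1) by auto
  ultimately show thesis using that by blast
qed

lemma eq_if_functionals_eq:
  fixes x y :: "'a::complex_vector"
  assumes "\<And>g :: 'a \<Rightarrow> complex. clinear g \<Longrightarrow> g x = g y"
  shows "x = y"
  using functionals_separate[of "x - y"] assms by (auto simp: clinear_diff)

text \<open>The coordinate functionals \<open>u b\<close> are defined on the whole algebra, as coordinates of \<open>e * x\<close>.\<close>

lemma finite_dimensional_coordinates:
  fixes e :: "'a::complex_algebra"
  assumes "finite_dimensional (range ((*) e))"
  obtains B :: "'a set" and u :: "'a \<Rightarrow> 'a \<Rightarrow> complex"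
  where "finite B" "cvec.independent B" "B \<subseteq> range ((*) e)"
    "\<And>b. clinear (u b)" "\<And>x. e * x = (\<Sum>b\<in>B. u b x *\<^sub>C b)"
proof -
  obtain S where S: "finite S" "range ((*) e) \<subseteq> cvec.span S"
    using assms by (auto simp: finite_dimensional_def)
  obtain B where B: "B \<subseteq> range ((*) e)" "cvec.independent B" "range ((*) e) \<subseteq> cvec.span B"
    using cvec.maximal_independent_subset[of "range ((*) e)"] by blast
  have fin: "finite B" using cvec.independent_span_bound[of S B] S B by blast
  define u where "u = (\<lambda>b x. cvec.representation B (e * x) b)"
  have sp: "e * x \<in> cvec.span B" for x using B(3) by blast
  have lin: "clinear (u b)" for b
    using B(2) sp by (intro clinearI)
      (simp_all add: u_def distrib_left mult_scaleC_right cvec.representation_add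
        cvec.representation_scale scaleC_complex)
  show thesis
  proof (rule that[OF fin B(2) B(1) lin])
    show "e * x = (\<Sum>b\<in>B. u b x *\<^sub>C b)" for x
      unfolding u_def using cvec.sum_representation_eq[OF B(2) sp fin] by simp
  qed
qed

lemma tens_sum_left: "(\<Sum>i\<in>I. x i) \<otimes>\<^sub>t a = (\<Sum>i\<in>I. x i \<otimes>\<^sub>t a)"
  by (induction I rule: infinite_finite_induct) (auto simp: tens_add_left)

lemma tensor_expansion:
  fixes t :: "'b::complex_vector \<otimes> 'a::complex_vector"
  obtains S q where "finite S" "cvec.independent S" "t = (\<Sum>x\<in>S. x \<otimes>\<^sub>t q x)"
proof -
  obtain B :: "'b set" where B: "cvec.independent B" "UNIV \<subseteq> cvec.span B"
    using cvec.maximal_independent_subset[of "UNIV :: 'b set"] by blast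
  have "\<exists>S q. finite S \<and> S \<subseteq> B \<and> t = (\<Sum>x\<in>S. x \<otimes>\<^sub>t q x)"
  proof (induction t rule: tensor_induct)
    case (tens b a)
    let ?r = "cvec.representation B b"
    have "b = (\<Sum>v | ?r v \<noteq> 0. ?r v *\<^sub>C v)"
      using cvec.sum_nonzero_representation_eq[OF B(1), of b] B(2) by (simp add: subset_iff)
    then have "b \<otimes>\<^sub>t a = (\<Sum>v | ?r v \<noteq> 0. ?r v *\<^sub>C v) \<otimes>\<^sub>t a" by simp
    also have "\<dots> = (\<Sum>v | ?r v \<noteq> 0. v \<otimes>\<^sub>t (?r v *\<^sub>C a))"
      by (simp add: tens_sum_left tens_scaleC_left tens_scaleC_right)
    finally show ?case
      using cvec.finite_representation cvec.representation_ne_zero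
      by (intro exI[of _ "{v. ?r v \<noteq> 0}"] exI[of _ "\<lambda>v. ?r v *\<^sub>C a"]) auto
  next
    case (add s t)
    then obtain S q S' q' where
      S: "finite S" "S \<subseteq> B" "s = (\<Sum>x\<in>S. x \<otimes>\<^sub>t q x)" and
      S': "finite S'" "S' \<subseteq> B" "t = (\<Sum>x\<in>S'. x \<otimes>\<^sub>t q' x)" by blast
    let ?q = "\<lambda>x. (if x \<in> S then q x else 0) + (if x \<in> S' then q' x else 0)"
    have "s = (\<Sum>x\<in>S \<union> S'. x \<otimes>\<^sub>t (if x \<in> S then q x else 0))"
      unfolding S(3) using S S' by (intro sum.mono_neutral_cong_left) auto
    moreover have "t = (\<Sum>x\<in>S \<union> S'. x \<otimes>\<^sub>t (if x \<in> S' then q' x else 0))"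
      unfolding S'(3) using S S' by (intro sum.mono_neutral_cong_left) auto
    ultimately have "s + t = (\<Sum>x\<in>S \<union> S'. x \<otimes>\<^sub>t ?q x)"
      by (simp add: sum.distrib tens_add_right)
    then show ?case using S S' by (intro exI[of _ "S \<union> S'"] exI[of _ ?q]) auto
  qed
  then obtain S q where "finite S" "S \<subseteq> B" "t = (\<Sum>x\<in>S. x \<otimes>\<^sub>t q x)" by blast
  then show thesis using that cvec.independent_mono[OF B(1)] by blast
qed

lemma bilinear_id_tensor: "clinear g \<Longrightarrow> cbilinear (\<lambda>b a. g a *\<^sub>C b)"
  by (intro bilinearI)
    (simp_all add: clinear_add clinear_scaleC scaleC_add_right scaleC_add_left scaleC_scaleC
      scaleC_complex mult.commute)

lemma id_tensor_tens: "clinear g \<Longrightarrow> id_tensor_functional g (b \<otimes>\<^sub>t a) = g a *\<^sub>C b"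
  by (simp add: id_tensor_functional_def tensor_lift_tens bilinear_id_tensor)

lemma clinear_id_tensor: "clinear g \<Longrightarrow> clinear (id_tensor_functional g)"
  unfolding id_tensor_functional_def by (intro clinear_tensor_lift bilinear_id_tensor)

lemma id_tensor_zero: "clinear g \<Longrightarrow> id_tensor_functional g 0 = 0"
  by (rule clinear_zero[OF clinear_id_tensor])

lemma id_tensor_add: "clinear g \<Longrightarrow>
    id_tensor_functional g (s + t) = id_tensor_functional g s + id_tensor_functional g t"
  by (rule clinear_add[OF clinear_id_tensor])

lemma tensor_map_add: "clinear f \<Longrightarrow> clinear g \<Longrightarrow>
    tensor_map f g (s + t) = tensor_map f g s + tensor_map f g t"
  by (rule clinear_add[OF clinear_tensor_map])

lemma id_tensor_add_functional:
  assumes "clinear g" "clinear h"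
  shows "id_tensor_functional (\<lambda>x. g x + h x) t = id_tensor_functional g t + id_tensor_functional h t"
proof -
  have gh: "clinear (\<lambda>x. g x + h x)"
    using assms by (auto simp: clinear_iff scaleC_add_right algebra_simps)
  show ?thesis
    by (induction t rule: tensor_induct)
      (simp_all add: id_tensor_tens gh assms scaleC_add_left id_tensor_add)
qed

lemma id_tensor_scale_functional:
  assumes "clinear g"
  shows "id_tensor_functional (\<lambda>x. k * g x) t = k *\<^sub>C id_tensor_functional g t"
proof -
  have gh: "clinear (\<lambda>x. k * g x)"
    using assms by (auto simp: clinear_iff scaleC_complex algebra_simps)
  show ?thesis
    by (induction t rule: tensor_induct)
      (simp_all add: id_tensor_tens gh assms scaleC_add_right scaleC_scaleC id_tensor_add)
qed

text \<open>The expansion of a tensor along independent left legs serves all functionals on the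
  right leg at once.\<close>

lemma tensor_slices:
  fixes t :: "'b::complex_vector \<otimes> 'a::complex_vector"
  obtains S q where "finite S" "t = (\<Sum>x\<in>S. x \<otimes>\<^sub>t q x)"
    "\<And>g x. clinear g \<Longrightarrow> id_tensor_functional g t = 0 \<Longrightarrow> x \<in> S \<Longrightarrow> g (q x) = 0"
proof -
  obtain S q where S: "finite S" "cvec.independent S" "t = (\<Sum>x\<in>S. x \<otimes>\<^sub>t q x)"
    by (rule tensor_expansion)
  show thesis
  proof (rule that[OF S(1,3)])
    fix g :: "'a \<Rightarrow> complex" and x
    assume g: "clinear g" and z: "id_tensor_functional g t = 0" and x: "x \<in> S"
    have "id_tensor_functional g t = (\<Sum>x\<in>S. g (q x) *\<^sub>C x)"
      unfolding S(3) by (simp add: clinear_sum[OF clinear_id_tensor[OF g]] id_tensor_tens g)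
    then have "(\<Sum>x\<in>S. g (q x) *\<^sub>C x) = 0" using z by simp
    from cvec.independentD[OF S(2,1) subset_refl this x] show "g (q x) = 0" .
  qed
qed

lemma tensor_zero_if_slices_zero:
  fixes t :: "'b::complex_vector \<otimes> 'a::complex_vector"
  assumes "\<And>g :: 'a \<Rightarrow> complex. clinear g \<Longrightarrow> id_tensor_functional g t = 0"
  shows "t = 0"
proof -
  obtain S q where S: "finite S" "t = (\<Sum>x\<in>S. x \<otimes>\<^sub>t q x)"
    "\<And>g x. clinear g \<Longrightarrow> id_tensor_functional g t = 0 \<Longrightarrow> x \<in> S \<Longrightarrow> g (q x) = 0"
    using tensor_slices[of t] by blast
  have "q x = 0" if "x \<in> S" for x
    by (rule eq_if_functionals_eq) (use S(3) assms that in \<open>auto simp: clinear_zero\<close>)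
  then show ?thesis unfolding S(2) by simp
qed

lemma tensor_eq_if_slices_eq:
  assumes "\<And>g. clinear g \<Longrightarrow> id_tensor_functional g s = id_tensor_functional g t"
  shows "s = t"
  using tensor_zero_if_slices_zero[of "s - t"] assms by (auto simp: clinear_diff[OF clinear_id_tensor])

lemma tens_eq_zeroD:
  assumes "b \<otimes>\<^sub>t a = 0"
  shows "b = 0 \<or> a = 0"
proof (rule ccontr)
  assume *: "\<not> (b = 0 \<or> a = 0)"
  then obtain g :: "_ \<Rightarrow> complex" where g: "clinear g" "g a \<noteq> 0" using functionals_separate[of a] by blast
  have "g a *\<^sub>C b = 0" using id_tensor_tens[OF g(1), of b a] assms by (simp add: id_tensor_zero[OF g(1)])
  then show False using g * by simp
qed

lemma id_tensor_times_left:
  assumes "clinear g"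
  shows "id_tensor_functional g ((b \<otimes>\<^sub>t a) * t) = b * id_tensor_functional (\<lambda>y. g (a * y)) t"
proof -
  have "clinear (\<lambda>y. g (a * y))" by (rule clinear_compose[OF assms clinear_times_left])
  then show ?thesis
    by (induction t rule: tensor_induct)
      (simp_all add: distrib_left id_tensor_add id_tensor_tens tens_times_tens
        assms mult_scaleC_right)
qed

lemma id_tensor_times_right:
  assumes "clinear g"
  shows "id_tensor_functional g (t * (b \<otimes>\<^sub>t a)) = id_tensor_functional (\<lambda>y. g (y * a)) t * b"
proof -
  have "clinear (\<lambda>y. g (y * a))" by (rule clinear_compose[OF assms clinear_times_right])
  then show ?thesis
    by (induction t rule: tensor_induct)
      (simp_all add: distrib_right id_tensor_add id_tensor_tens tens_times_tens
        assms mult_scaleC_left)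
qed

lemma id_tensor_map_right:
  assumes "clinear f" "clinear g"
  shows "id_tensor_functional g (tensor_map id f t) = id_tensor_functional (\<lambda>y. g (f y)) t"
proof -
  have "clinear (\<lambda>y. g (f y))" by (rule clinear_compose[OF assms(2,1)])
  then show ?thesis
    by (induction t rule: tensor_induct)
      (simp_all add: id_tensor_tens tensor_map_tens tensor_map_add clinear_id assms id_tensor_add)
qed


section \<open>Non degenerate products and multipliers\<close>

lemma nondegenerate_left:
  "nondegenerate_product TYPE('a::complex_algebra) \<Longrightarrow> (\<And>s::'a. s * x = s * y) \<Longrightarrow> x = y"
  unfolding nondegenerate_product_def by (metis eq_iff_diff_eq_0 right_diff_distrib)

lemma nondegenerate_right:
  "nondegenerate_product TYPE('a::complex_algebra) \<Longrightarrow> (\<And>s::'a. x * s = y * s) \<Longrightarrow> x = y"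
  unfolding nondegenerate_product_def by (metis eq_iff_diff_eq_0 left_diff_distrib)

text \<open>If \<open>s * t = 0\<close> for all \<open>s\<close>, then all slices of \<open>t\<close> by functionals \<open>y \<mapsto> g (a * y)\<close> vanish, so that
  every right leg in an expansion of \<open>t\<close> along independent left legs is zero. The other side is symmetric.\<close>

lemma nondegenerate_tensor:
  assumes B: "nondegenerate_product TYPE('b::complex_algebra)"
    and A: "nondegenerate_product TYPE('a::complex_algebra)"
  shows "nondegenerate_product TYPE('b \<otimes> 'a)"
proof -
  have "t = 0" if t: "\<And>s. s * t = 0" for t :: "'b \<otimes> 'a"
  proof -
    obtain S q where S: "finite S" "t = (\<Sum>x\<in>S. x \<otimes>\<^sub>t q x)"
      "\<And>g x. clinear g \<Longrightarrow> id_tensor_functional g t = 0 \<Longrightarrow> x \<in> S \<Longrightarrow> g (q x) = 0"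
      using tensor_slices[of t] by blast
    have "q x = 0" if x: "x \<in> S" for x
    proof (rule nondegenerate_left[OF A])
      fix a
      show "a * q x = a * 0"
      proof (rule eq_if_functionals_eq)
        fix g :: "'a \<Rightarrow> complex" assume g: "clinear g"
        have "b * id_tensor_functional (\<lambda>y. g (a * y)) t = b * 0" for b
          using id_tensor_times_left[OF g, of b a t] t by (simp add: id_tensor_zero[OF g])
        from nondegenerate_left[OF B this] have "id_tensor_functional (\<lambda>y. g (a * y)) t = 0" .
        from S(3)[OF clinear_compose[OF g clinear_times_left] this x]
        show "g (a * q x) = g (a * 0)" using clinear_zero[OF g] by simp
      qed
    qed
    then show ?thesis unfolding S(2) by simp
  qed
  moreover have "t = 0" if t: "\<And>s. t * s = 0" for t :: "'b \<otimes> 'a"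
  proof -
    obtain S q where S: "finite S" "t = (\<Sum>x\<in>S. x \<otimes>\<^sub>t q x)"
      "\<And>g x. clinear g \<Longrightarrow> id_tensor_functional g t = 0 \<Longrightarrow> x \<in> S \<Longrightarrow> g (q x) = 0"
      using tensor_slices[of t] by blast
    have "q x = 0" if x: "x \<in> S" for x
    proof (rule nondegenerate_right[OF A])
      fix a
      show "q x * a = 0 * a"
      proof (rule eq_if_functionals_eq)
        fix g :: "'a \<Rightarrow> complex" assume g: "clinear g"
        have "id_tensor_functional (\<lambda>y. g (y * a)) t * b = 0 * b" for b
          using id_tensor_times_right[OF g, of t b a] t by (simp add: id_tensor_zero[OF g])
        from nondegenerate_right[OF B this] have "id_tensor_functional (\<lambda>y. g (y * a)) t = 0" .
        from S(3)[OF clinear_compose[OF g clinear_times_right] this x]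
        show "g (q x * a) = g (0 * a)" using clinear_zero[OF g] by simp
      qed
    qed
    then show ?thesis unfolding S(2) by simp
  qed
  ultimately show ?thesis unfolding nondegenerate_product_def by blast
qed

lemma mult_right_times:
  fixes s t :: "'a::complex_algebra"
  assumes "nondegenerate_product TYPE('a::complex_algebra)"
  shows "(s * t) \<lhd> m = s * (t \<lhd> m)"
  by (rule nondegenerate_right[OF assms]) (simp add: multiplier_balanced mult.assoc)

lemma of_alg_left: "of_alg a \<rhd> b = a * b" and of_alg_right: "b \<lhd> of_alg a = b * a"
  by (transfer, simp)+

lemma times_multiplier_left: "(m * n) \<rhd> a = m \<rhd> (n \<rhd> a)"
  and times_multiplier_right: "a \<lhd> (m * n) = (a \<lhd> m) \<lhd> n"
  by (transfer, auto)+

lemma one_multiplier_right: "a \<lhd> 1 = a"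
  by transfer simp

lemma of_alg_eqD:
  assumes "nondegenerate_product TYPE('a::complex_algebra)" "of_alg a = of_alg (b::'a)"
  shows "a = b"
proof (rule nondegenerate_right[OF assms(1)])
  show "a * s = b * s" for s using of_alg_left[of a s] assms(2) by (simp add: of_alg_left)
qed

lemma of_alg_times_multiplier:
  fixes a :: "'a::complex_algebra"
  assumes "nondegenerate_product TYPE('a::complex_algebra)"
  shows "of_alg a * m = of_alg (a \<lhd> m)"
  by (rule multiplier_eqI)
    (simp_all add: times_multiplier_left times_multiplier_right of_alg_left of_alg_right
      multiplier_balanced mult_right_times[OF assms])

lemma of_alg_times: "of_alg (a * b) = of_alg a * of_alg b"
  by (rule multiplier_eqI)
    (simp_all add: times_multiplier_left times_multiplier_right of_alg_left of_alg_right mult.assoc)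

lemma multiplier_ext_tens:
  fixes m n :: "('b::complex_algebra \<otimes> 'a::complex_algebra) multiplier"
  assumes "\<And>b a. m \<rhd> (b \<otimes>\<^sub>t a) = n \<rhd> (b \<otimes>\<^sub>t a)" "\<And>b a. (b \<otimes>\<^sub>t a) \<lhd> m = (b \<otimes>\<^sub>t a) \<lhd> n"
  shows "m = n"
proof (rule multiplier_eqI)
  show "m \<rhd> t = n \<rhd> t" for t
    by (induction t rule: tensor_induct) (simp_all add: assms clinear_add[OF clinear_mult_left])
  show "t \<lhd> m = t \<lhd> n" for t
    by (induction t rule: tensor_induct) (simp_all add: assms clinear_add[OF clinear_mult_right])
qed


section \<open>Matrix units and central local units\<close>

text \<open>A central idempotent, not necessarily nonzero.\<close>

definition central_idempotent :: "'a::complex_algebra \<Rightarrow> bool" where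
  "central_idempotent e \<longleftrightarrow> (\<forall>x. e * x = x * e) \<and> e * e = e"

text \<open>Every finite set of elements has a common central idempotent unit \<open>e\<close> whose ideal \<open>e \<A>\<close> is
  finite dimensional. In a direct sum of matrix algebras \<open>e\<close> is the sum of the units of the
  finitely many blocks involved.\<close>

definition central_local_units :: "'a::complex_algebra itself \<Rightarrow> bool" where
  "central_local_units _ \<longleftrightarrow> (\<forall>S::'a set. finite S \<longrightarrow>
     (\<exists>e. central_idempotent e \<and> finite_dimensional (range ((*) e)) \<and> (\<forall>x\<in>S. e * x = x)))"

text \<open>\<open>c i k l x\<close> is the entry \<open>(k, l)\<close> of the block \<open>i\<close> of \<open>x\<close>, a matrix of size \<open>n i\<close>, and the
  elements \<open>E i k l\<close> are the matrix units.\<close>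

locale matrix_coordinates =
  fixes J :: "'i set" and n :: "'i \<Rightarrow> nat"
    and c :: "'i \<Rightarrow> nat \<Rightarrow> nat \<Rightarrow> 'a::complex_algebra \<Rightarrow> complex" and E :: "'i \<Rightarrow> nat \<Rightarrow> nat \<Rightarrow> 'a"
  assumes lin: "i \<in> J \<Longrightarrow> k < n i \<Longrightarrow> l < n i \<Longrightarrow> clinear (c i k l)"
    and sep: "(\<And>i k l. i \<in> J \<Longrightarrow> k < n i \<Longrightarrow> l < n i \<Longrightarrow> c i k l x = c i k l y) \<Longrightarrow> x = y"
    and mult: "i \<in> J \<Longrightarrow> k < n i \<Longrightarrow> l < n i \<Longrightarrow> c i k l (x * y) = (\<Sum>m<n i. c i k m x * c i m l y)"
    and cE: "i \<in> J \<Longrightarrow> k < n i \<Longrightarrow> l < n i \<Longrightarrow> j \<in> J \<Longrightarrow> p < n j \<Longrightarrow> q < n j \<Longrightarrow>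
      c j p q (E i k l) = (if j = i \<and> p = k \<and> q = l then 1 else 0)"
    and fin: "finite {i \<in> J. \<exists>k<n i. \<exists>l<n i. c i k l x \<noteq> 0}"
begin

text \<open>\<open>F\<close> may be any finite set of blocks that contains those where \<open>x\<close> is nonzero.\<close>

lemma expand:
  assumes F: "finite F" "F \<subseteq> J" "\<And>i k l. i \<in> J - F \<Longrightarrow> k < n i \<Longrightarrow> l < n i \<Longrightarrow> c i k l x = 0"
  shows "x = (\<Sum>i\<in>F. \<Sum>k<n i. \<Sum>l<n i. c i k l x *\<^sub>C E i k l)"
proof (rule sep)
  fix j p q assume j: "j \<in> J" "p < n j" "q < n j"
  have "c j p q (\<Sum>i\<in>F. \<Sum>k<n i. \<Sum>l<n i. c i k l x *\<^sub>C E i k l) =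
      (\<Sum>i\<in>F. \<Sum>k<n i. \<Sum>l<n i. c i k l x * c j p q (E i k l))"
    by (simp add: clinear_sum[OF lin[OF j]] clinear_scaleC[OF lin[OF j]] scaleC_complex)
  also have "\<dots> = (\<Sum>i\<in>F. \<Sum>k<n i. \<Sum>l<n i.
      if l = q then (if k = p then (if i = j then c j p q x else 0) else 0) else 0)"
    using F(2) j by (intro sum.cong refl) (auto simp: cE subset_iff)
  also have "\<dots> = (\<Sum>i\<in>F. if i = j then c j p q x else 0)"
    using j by (intro sum.cong refl) (auto intro!: sum.neutral)
  also have "\<dots> = (if j \<in> F then c j p q x else 0)" using F(1) by simp
  also have "\<dots> = c j p q x" using F(3)[of j p q] j by simp
  finally show "c j p q x = c j p q (\<Sum>i\<in>F. \<Sum>k<n i. \<Sum>l<n i. c i k l x *\<^sub>C E i k l)" by simp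
qed

lemma central_local_units:
  shows "central_local_units TYPE('a)"
  unfolding central_local_units_def
proof (intro allI impI)
  fix S :: "'a set" assume S: "finite S"
  define F where "F = (\<Union>x\<in>S. {i \<in> J. \<exists>k<n i. \<exists>l<n i. c i k l x \<noteq> 0})"
  have F: "finite F" "F \<subseteq> J" using S fin by (auto simp: F_def)
  define e where "e = (\<Sum>i\<in>F. \<Sum>k<n i. E i k k)"
  have ce: "c j p q e = (if j \<in> F \<and> p = q then 1 else 0)" if j: "j \<in> J" "p < n j" "q < n j" for j p q
  proof -
    have "c j p q e = (\<Sum>i\<in>F. \<Sum>k<n i. c j p q (E i k k))"
      unfolding e_def by (simp add: clinear_sum[OF lin[OF j]])
    also have "\<dots> = (\<Sum>i\<in>F. if i = j then (\<Sum>k<n i. if k = p then (if p = q then 1 else 0) else 0) else 0)"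
      using F(2) j by (intro sum.cong refl) (auto simp: cE subset_iff intro!: sum.cong sum.neutral)
    also have "\<dots> = (if j \<in> F \<and> p = q then 1 else 0)" using F j by simp
    finally show ?thesis .
  qed
  have ex: "c j p q (e * x) = (if j \<in> F then c j p q x else 0)"
    and xe: "c j p q (x * e) = (if j \<in> F then c j p q x else 0)"
    if j: "j \<in> J" "p < n j" "q < n j" for j p q x
  proof -
    have "c j p q (e * x) = (\<Sum>m<n j. c j p m e * c j m q x)" using j by (simp add: mult)
    also have "\<dots> = (\<Sum>m<n j. if m = p then (if j \<in> F then c j p q x else 0) else 0)"
      using j by (intro sum.cong refl) (auto simp: ce)
    finally show "c j p q (e * x) = (if j \<in> F then c j p q x else 0)" using j by simp
    have "c j p q (x * e) = (\<Sum>m<n j. c j p m x * c j m q e)" using j by (simp add: mult)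
    also have "\<dots> = (\<Sum>m<n j. if m = q then (if j \<in> F then c j p q x else 0) else 0)"
      using j by (intro sum.cong refl) (auto simp: ce)
    finally show "c j p q (x * e) = (if j \<in> F then c j p q x else 0)" using j by simp
  qed
  have "central_idempotent e"
    unfolding central_idempotent_def by (intro conjI allI sep) (simp_all add: ex xe ce)
  moreover have "e * x = x" if "x \<in> S" for x
    using that by (intro sep) (auto simp: ex F_def)
  moreover have "finite_dimensional (range ((*) e))"
  proof -
    let ?T = "\<Union>i\<in>F. \<Union>k\<in>{..<n i}. \<Union>l\<in>{..<n i}. {E i k l}"
    have expand_ex: "e * x = (\<Sum>i\<in>F. \<Sum>k<n i. \<Sum>l<n i. c i k l (e * x) *\<^sub>C E i k l)" for x
      using F by (intro expand) (simp_all add: ex)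
    have "e * x \<in> cvec.span ?T" for x
      by (subst expand_ex, intro cvec.span_sum cvec.span_scale cvec.span_base) auto
    then have "range ((*) e) \<subseteq> cvec.span ?T" by (auto simp del: UN_iff)
    then show ?thesis unfolding finite_dimensional_def using F(1) by (intro exI[of _ ?T]) auto
  qed
  ultimately show "\<exists>e. central_idempotent e \<and> finite_dimensional (range ((*) e)) \<and> (\<forall>x\<in>S. e * x = x)"
    by blast
qed

text \<open>The left ideal of all \<open>a\<close> with \<open>\<phi> (b * a) = 0\<close> for all \<open>b\<close> has a nonzero right annihilator,
  for every nonzero linear functional \<open>\<phi>\<close>, invariant or not.\<close>

lemma kernel_ideal_annihilated:
  fixes \<phi> :: "'a \<Rightarrow> complex"
  assumes \<phi>: "clinear \<phi>" "\<phi> \<noteq> (\<lambda>_. 0)"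
  obtains y where "y \<noteq> 0" "\<And>a. (\<And>b. \<phi> (b * a) = 0) \<Longrightarrow> a * y = 0"
proof -
  have "\<exists>j k l. j \<in> J \<and> k < n j \<and> l < n j \<and> \<phi> (E j k l) \<noteq> 0"
  proof (rule ccontr)
    assume "\<not> ?thesis"
    then have 0: "\<phi> (E j k l) = 0" if "j \<in> J" "k < n j" "l < n j" for j k l using that by blast
    have "\<phi> x = 0" for x
    proof -
      define F where "F = {i \<in> J. \<exists>k<n i. \<exists>l<n i. c i k l x \<noteq> 0}"
      have F: "finite F" "F \<subseteq> J" using fin by (auto simp: F_def)
      have "x = (\<Sum>i\<in>F. \<Sum>k<n i. \<Sum>l<n i. c i k l x *\<^sub>C E i k l)"
        using F by (intro expand) (auto simp: F_def)
      then have "\<phi> x = \<phi> (\<Sum>i\<in>F. \<Sum>k<n i. \<Sum>l<n i. c i k l x *\<^sub>C E i k l)" by simp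
      also have "\<dots> = 0"
        using F(2) by (simp add: clinear_sum[OF \<phi>(1)] clinear_scaleC[OF \<phi>(1)] scaleC_complex 0 subset_iff)
      finally show ?thesis .
    qed
    then show False using \<phi>(2) by blast
  qed
  then obtain j k l where j: "j \<in> J" "k < n j" "l < n j" and nz: "\<phi> (E j k l) \<noteq> 0" by blast
  \<comment> \<open>In the block \<open>j\<close> the functional is \<open>x \<mapsto> Tr (h x)\<close> for a matrix \<open>h\<close>, and \<open>y\<close> is a
    nonzero column of \<open>h\<close>.\<close>
  define y where "y = (\<Sum>m<n j. \<phi> (E j k m) *\<^sub>C E j m k)"
  have cy: "c i p q y = (if i = j \<and> q = k then \<phi> (E j k p) else 0)"
    if i: "i \<in> J" "p < n i" "q < n i" for i p q
  proof -
    have "c i p q y = (\<Sum>m<n j. \<phi> (E j k m) * c i p q (E j m k))"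
      unfolding y_def by (simp add: clinear_sum[OF lin[OF i]] clinear_scaleC[OF lin[OF i]] scaleC_complex)
    also have "\<dots> = (\<Sum>m<n j. if m = p then (if i = j \<and> q = k then \<phi> (E j k p) else 0) else 0)"
      using i j by (intro sum.cong refl) (auto simp: cE)
    finally show ?thesis using i by auto
  qed
  show thesis
  proof (rule that[of y])
    show "y \<noteq> 0" using cy[of j l k] j nz clinear_zero[OF lin, of j l k] by auto
    fix a assume a: "\<And>b. \<phi> (b * a) = 0"
    show "a * y = 0"
    proof (rule sep)
      fix i p q assume i: "i \<in> J" "p < n i" "q < n i"
      have "c i p q (a * y) = (\<Sum>m<n i. c i p m a * (if i = j \<and> q = k then \<phi> (E j k m) else 0))"
        using i by (simp add: mult cy)
      also have "\<dots> = 0"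
      proof (cases "i = j \<and> q = k")
        case True
        have "E j k p * a = (\<Sum>m<n j. c j p m a *\<^sub>C E j k m)"
        proof (rule sep)
          fix i' p' q' assume i': "i' \<in> J" "p' < n i'" "q' < n i'"
          have "c i' p' q' (E j k p * a) =
              (\<Sum>m<n i'. c i' p' m (E j k p) * c i' m q' a)"
            using i' by (simp add: mult)
          also have "\<dots> = (\<Sum>m<n i'. if m = p then (if i' = j \<and> p' = k then c j p q' a else 0) else 0)"
            using i' j i True by (intro sum.cong refl) (auto simp: cE)
          also have "\<dots> = (if i' = j \<and> p' = k then c j p q' a else 0)"
            using i i' True by auto
          finally have 1: "c i' p' q' (E j k p * a) = (if i' = j \<and> p' = k then c j p q' a else 0)" .
          have "c i' p' q' (\<Sum>m<n j. c j p m a *\<^sub>C E j k m) =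
              (\<Sum>m<n j. c j p m a * c i' p' q' (E j k m))"
            by (simp add: clinear_sum[OF lin[OF i']] clinear_scaleC[OF lin[OF i']] scaleC_complex)
          also have "\<dots> = (\<Sum>m<n j. if m = q' then (if i' = j \<and> p' = k then c j p q' a else 0) else 0)"
            using i' j i True by (intro sum.cong refl) (auto simp: cE)
          also have "\<dots> = (if i' = j \<and> p' = k then c j p q' a else 0)"
            using i' by auto
          finally show "c i' p' q' (E j k p * a) = c i' p' q' (\<Sum>m<n j. c j p m a *\<^sub>C E j k m)"
            using 1 by simp
        qed
        then have "\<phi> (E j k p * a) = (\<Sum>m<n j. c j p m a * \<phi> (E j k m))"
          by (simp add: clinear_sum[OF \<phi>(1)] clinear_scaleC[OF \<phi>(1)] scaleC_complex)
        then show ?thesis using a True by simp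
      qed auto
      finally show "c i p q (a * y) = c i p q 0" using clinear_zero[OF lin[OF i]] by simp
    qed
  qed
qed

end

lemma direct_sum_of_matrix_algebras_coordinates:
  assumes "direct_sum_of_matrix_algebras TYPE('a::complex_algebra)"
  obtains J :: "'a::complex_algebra set" and n c and E :: "'a \<Rightarrow> nat \<Rightarrow> nat \<Rightarrow> 'a"
  where "matrix_coordinates J n c E"
proof -
  obtain J :: "'a set" and n :: "'a \<Rightarrow> nat" and \<Phi> :: "'a \<Rightarrow> 'a \<Rightarrow> complex mat" where
    bij: "bij_betw \<Phi> UNIV (matrix_direct_sum J n)" and
    add: "\<forall>x y. \<forall>i\<in>J. \<Phi> (x + y) i = \<Phi> x i + \<Phi> y i" and
    scale: "\<forall>c x. \<forall>i\<in>J. \<Phi> (c *\<^sub>C x) i = c \<cdot>\<^sub>m \<Phi> x i" and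
    times: "\<forall>x y. \<forall>i\<in>J. \<Phi> (x * y) i = \<Phi> x i * \<Phi> y i"
    using assms unfolding direct_sum_of_matrix_algebras_def by blast
  have \<Phi>: "\<Phi> x \<in> matrix_direct_sum J n" for x using bij by (auto simp: bij_betw_def)
  have carrier: "\<Phi> x i \<in> carrier_mat (n i) (n i)" if "i \<in> J" for x i
    using \<Phi>[of x] that by (auto simp: matrix_direct_sum_def)
  have dim: "dim_row (\<Phi> x i) = n i" "dim_col (\<Phi> x i) = n i" if "i \<in> J" for x i
    using carrier_matD[OF carrier[OF that]] by blast+
  define c where "c = (\<lambda>i k l x. \<Phi> x i $$ (k, l))"
  define U :: "'a \<Rightarrow> nat \<Rightarrow> nat \<Rightarrow> 'a \<Rightarrow> complex mat" where "U = (\<lambda>i k l. \<lambda>j\<in>J. mat (n j) (n j)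
    (\<lambda>(p, q). if j = i \<and> p = k \<and> q = l then 1 else 0))"
  have U: "U i k l \<in> matrix_direct_sum J n" for i k l
  proof -
    have "{j \<in> J. U i k l j \<noteq> 0\<^sub>m (n j) (n j)} \<subseteq> {i}"
      by (auto simp: U_def intro!: eq_matI)
    then have "finite {j \<in> J. U i k l j \<noteq> 0\<^sub>m (n j) (n j)}" by (rule finite_subset) simp
    then show ?thesis by (auto simp: matrix_direct_sum_def U_def)
  qed
  define E where "E = (\<lambda>i k l. inv_into UNIV \<Phi> (U i k l))"
  have \<Phi>E: "\<Phi> (E i k l) = U i k l" for i k l
    unfolding E_def using U bij by (metis bij_betw_imp_surj_on f_inv_into_f)
  have lin: "clinear (c i k l)" if "i \<in> J" "k < n i" "l < n i" for i k l
    using that dim by (intro clinearI) (simp_all add: c_def add scale scaleC_complex)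
  have sep: "x = y" if "\<And>i k l. i \<in> J \<Longrightarrow> k < n i \<Longrightarrow> l < n i \<Longrightarrow> c i k l x = c i k l y" for x y
  proof -
    have "\<Phi> x = \<Phi> y"
    proof
      fix i show "\<Phi> x i = \<Phi> y i"
      proof (cases "i \<in> J")
        case True
        then show ?thesis using that dim by (intro eq_matI) (auto simp: c_def)
      next
        case False
        then show ?thesis using \<Phi>[of x] \<Phi>[of y]
          by (auto simp: matrix_direct_sum_def PiE_def extensional_def)
      qed
    qed
    then show ?thesis using bij by (auto simp: bij_betw_def inj_def)
  qed
  have cE: "c j p q (E i k l) = (if j = i \<and> p = k \<and> q = l then 1 else 0)"
    if "i \<in> J" "k < n i" "l < n i" "j \<in> J" "p < n j" "q < n j" for i k l j p q
    using that by (simp add: c_def \<Phi>E U_def)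
  have fin: "finite {i \<in> J. \<exists>k<n i. \<exists>l<n i. c i k l x \<noteq> 0}" for x
  proof (rule finite_subset)
    show "finite {i \<in> J. \<Phi> x i \<noteq> 0\<^sub>m (n i) (n i)}"
      using \<Phi>[of x] by (simp add: matrix_direct_sum_def)
    show "{i \<in> J. \<exists>k<n i. \<exists>l<n i. c i k l x \<noteq> 0} \<subseteq> {i \<in> J. \<Phi> x i \<noteq> 0\<^sub>m (n i) (n i)}"
      by (auto simp: c_def)
  qed
  have mult: "c i k l (x * y) = (\<Sum>m<n i. c i k m x * c i m l y)"
    if "i \<in> J" "k < n i" "l < n i" for i k l x y
    using that dim[OF that(1)] by (simp add: c_def times scalar_prod_def atLeast0LessThan)
  have "matrix_coordinates J n c E"
    by (rule matrix_coordinates.intro) (fact lin sep mult cE fin)+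
  then show thesis by (rule that)
qed


section \<open>Faithfulness of the left invariant functional\<close>

text \<open>The set \<open>{a. \<forall>b. \<phi> (b * a) = 0}\<close> is a left ideal \<open>N\<close> with \<open>(\<A> \<otimes> \<A>)\<delta>(N) \<subseteq> \<A> \<otimes> N\<close>
  by left invariance and surjectivity of \<open>T\<^sub>2\<close>. Multiplying the right leg by an
  element \<open>y\<close> with \<open>N y = 0\<close> gives \<open>\<delta>(a)(I \<otimes> y) = 0\<close> for \<open>a\<close> in \<open>N\<close>, so that \<open>a \<otimes> y = 0\<close> by injectivity of \<open>T\<^sub>1\<close>.\<close>

lemma left_invariant_faithful:
  fixes \<delta> :: "'a::complex_algebra \<Rightarrow> ('a \<otimes> 'a) multiplier"
  assumes hopf: "multiplier_hopf_algebra \<delta>" and sum: "direct_sum_of_matrix_algebras TYPE('a)"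
    and inv: "left_invariant \<delta> \<phi>" and nz: "\<phi> \<noteq> (\<lambda>_. 0)"
    and a: "\<And>b. \<phi> (b * a) = 0"
  shows "a = 0"
proof -
  have \<phi>: "clinear \<phi>" using inv by (simp add: left_invariant_def)
  obtain J :: "'a set" and n c E where coords: "matrix_coordinates J n c (E :: _ \<Rightarrow> _ \<Rightarrow> _ \<Rightarrow> 'a)"
    using direct_sum_of_matrix_algebras_coordinates[OF sum] by blast
  obtain y where y: "y \<noteq> 0" "\<And>a. (\<And>b. \<phi> (b * a) = 0) \<Longrightarrow> a * y = 0"
    using matrix_coordinates.kernel_ideal_annihilated[OF coords \<phi> nz] by blast
  have nd: "nondegenerate_product TYPE('a)" and
    \<delta>_mult: "\<And>a b. \<delta> (a * b) = \<delta> a * \<delta> b"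
    using hopf by (auto simp: multiplier_hopf_algebra_def)
  have nd2: "nondegenerate_product TYPE('a \<otimes> 'a)" by (rule nondegenerate_tensor[OF nd nd])
  obtain T1 T2 :: "'a \<otimes> 'a \<Rightarrow> 'a \<otimes> 'a" where
    T1: "clinear T1" "\<And>a b. of_alg (T1 (a \<otimes>\<^sub>t b)) = \<delta> a * multiplier_tens 1 (of_alg b)" "bij T1" and
    T2: "clinear T2" "\<And>a b. of_alg (T2 (a \<otimes>\<^sub>t b)) = multiplier_tens (of_alg a) 1 * \<delta> b" "bij T2"
    using hopf unfolding multiplier_hopf_algebra_def by blast
  have T2_inv: "id_tensor_functional \<phi> (T2 (c \<otimes>\<^sub>t x)) = \<phi> x *\<^sub>C c" for c x
  proof -
    obtain t where t: "of_alg t = multiplier_tens (of_alg c) 1 * \<delta> x"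
      "c \<lhd> (\<phi> x *\<^sub>C 1) = id_tensor_functional \<phi> t"
      using inv unfolding left_invariant_def is_partial_evaluation_def by blast
    have "t = T2 (c \<otimes>\<^sub>t x)" by (rule of_alg_eqD[OF nd2]) (simp add: t T2)
    then show ?thesis using t(2) by (simp add: mult_right_scaleC one_multiplier_right)
  qed
  have T2_\<delta>: "T2 (c \<otimes>\<^sub>t d) \<lhd> \<delta> x = T2 (c \<otimes>\<^sub>t (d * x))" for c d x
    by (rule of_alg_eqD[OF nd2])
      (simp add: of_alg_times_multiplier[OF nd2, symmetric] T2(2) \<delta>_mult mult.assoc)
  \<comment> \<open>As \<open>T\<^sub>2\<close> is onto, elements \<open>(c \<otimes> I)\<delta>(d)\<close> suffice for \<open>w\<close>, and
    \<open>(c \<otimes> I)\<delta>(d)\<delta>(a) = (c \<otimes> I)\<delta>(da)\<close> has the slice \<open>\<phi>(da)c = 0\<close>.\<close>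
  have id_\<phi>: "id_tensor_functional \<phi> (w \<lhd> \<delta> a) = 0" for w
  proof -
    obtain s where s: "w = T2 s" using T2(3) by (metis bij_pointE)
    show ?thesis
      unfolding s
      by (induction s rule: tensor_induct)
        (simp_all add: T2_\<delta> T2_inv a clinear_add[OF T2(1)] clinear_add[OF clinear_mult_right] id_tensor_add \<phi>)
  qed
  \<comment> \<open>The right legs of \<open>w \<delta>(a)\<close> lie in \<open>{q. \<forall>b. \<phi> (b * q) = 0}\<close>, so \<open>y\<close> annihilates them.\<close>
  have w: "tensor_map id (\<lambda>z. z * y) (w \<lhd> \<delta> a) = 0" for w
  proof -
    let ?u = "w \<lhd> \<delta> a"
    obtain S q where S: "finite S" "?u = (\<Sum>x\<in>S. x \<otimes>\<^sub>t q x)"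
      "\<And>g x. clinear g \<Longrightarrow> id_tensor_functional g ?u = 0 \<Longrightarrow> x \<in> S \<Longrightarrow> g (q x) = 0"
      using tensor_slices[of ?u] by blast
    have "q x * y = 0" if x: "x \<in> S" for x
    proof (rule y(2))
      fix b
      have "id_tensor_functional (\<lambda>z. \<phi> (b * z)) ?u = 0"
      proof (rule nondegenerate_left[OF nd])
        fix c
        have "c * id_tensor_functional (\<lambda>z. \<phi> (b * z)) ?u = id_tensor_functional \<phi> (((c \<otimes>\<^sub>t b) * w) \<lhd> \<delta> a)"
          by (simp add: id_tensor_times_left[OF \<phi>] mult_right_times[OF nd2])
        then show "c * id_tensor_functional (\<lambda>z. \<phi> (b * z)) ?u = c * 0" by (simp add: id_\<phi>)
      qed
      from S(3)[OF clinear_compose[OF \<phi> clinear_times_left] this x]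
      show "\<phi> (b * q x) = 0" .
    qed
    then show ?thesis
      unfolding S(2)
      by (simp add: clinear_sum[OF clinear_tensor_map] clinear_id clinear_times_right tensor_map_tens)
  qed
  have "T1 (a \<otimes>\<^sub>t y) = 0"
  proof (rule nondegenerate_left[OF nd2])
    fix w
    have right: "mult_right (of_alg y) = (\<lambda>z. z * y)" "mult_right (1::'a multiplier) = id"
      by (auto simp: of_alg_right one_multiplier_right)
    have "of_alg (w * T1 (a \<otimes>\<^sub>t y)) = (of_alg w * \<delta> a) * multiplier_tens 1 (of_alg y)"
      by (simp add: of_alg_times T1(2) mult.assoc)
    also have "\<dots> = of_alg ((w \<lhd> \<delta> a) \<lhd> multiplier_tens 1 (of_alg y))"
      by (simp add: of_alg_times_multiplier[OF nd2])
    also have "\<dots> = of_alg 0"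
      by (simp add: mult_right_multiplier_tens right w)
    finally show "w * T1 (a \<otimes>\<^sub>t y) = w * 0" by (simp add: of_alg_eqD[OF nd2])
  qed
  then have "T1 (a \<otimes>\<^sub>t y) = T1 0" by (simp add: clinear_zero[OF T1(1)])
  then have "a \<otimes>\<^sub>t y = 0" using T1(3) by (simp add: bij_is_inj inj_eq)
  then show ?thesis using tens_eq_zeroD y(1) by blast
qed


section \<open>Reduced functionals\<close>

text \<open>In an algebra with central local units the reduced functionals are the linear functionals
  \<open>\<xi>\<close> that live on \<open>e \<A>\<close> for some central idempotent \<open>e\<close>.\<close>

definition supported_by :: "'a::complex_algebra \<Rightarrow> ('a \<Rightarrow> complex) \<Rightarrow> bool" where
  "supported_by e \<xi> \<longleftrightarrow> central_idempotent e \<and> clinear \<xi> \<and> (\<forall>y. \<xi> (e * y) = \<xi> y)"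

lemma supported_by_right: "supported_by e \<xi> \<Longrightarrow> \<xi> (y * e) = \<xi> y"
  unfolding supported_by_def central_idempotent_def by metis

lemma supported_by_clinear: "supported_by e \<xi> \<Longrightarrow> clinear \<xi>"
  by (simp add: supported_by_def)

lemma supported_by_mono:
  assumes "supported_by e \<xi>" "central_idempotent e'" "e' * e = e"
  shows "supported_by e' \<xi>"
proof -
  have "\<xi> (e' * y) = \<xi> y" for y
  proof -
    have "\<xi> (e' * y) = \<xi> (e * (e' * y))" using assms(1) by (simp add: supported_by_def)
    also have "e * (e' * y) = (e' * e) * y"
      using assms(2) unfolding central_idempotent_def by (metis mult.assoc)
    also have "\<xi> \<dots> = \<xi> y" using assms(1,3) by (simp add: supported_by_def)
    finally show ?thesis .
  qed
  then show ?thesis using assms by (simp add: supported_by_def)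
qed

lemma common_central_unit:
  assumes "central_local_units TYPE('a::complex_algebra)" "finite (S::'a set)"
  obtains e where "central_idempotent e" "finite_dimensional (range ((*) e))"
    "\<And>x. x \<in> S \<Longrightarrow> e * x = x" "\<And>x. x \<in> S \<Longrightarrow> x * e = x"
proof -
  obtain e where e: "central_idempotent e" "finite_dimensional (range ((*) e))" "\<forall>x\<in>S. e * x = x"
    using assms unfolding central_local_units_def by blast
  then have "x * e = x" if "x \<in> S" for x
    using that unfolding central_idempotent_def by metis
  then show thesis using that e by blast
qed

lemma clinear_presented:
  assumes "is_presentation p"
  shows "clinear (presented p)"
  using assms
proof (induction p)
  case Nil
  show ?case by (intro clinearI) (simp_all add: presented_def)
next
  case (Cons t p)
  obtain a g b where t: "t = (a, g, b)" by (cases t)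
  have g: "clinear g" and p: "clinear (presented p)"
    using Cons by (auto simp: t is_presentation_def)
  have "presented (t # p) = (\<lambda>c. g (b * c * a) + presented p c)"
    by (auto simp: t presented_def)
  then show ?case
    using clinear_compose[OF g clinear_compose[OF clinear_times_right clinear_times_left], of b a] p
    by (auto simp: clinear_iff scaleC_add_right)
qed

text \<open>\<open>e\<close> acts as a two-sided unit on all algebra elements that occur in the presentation \<open>p\<close>.\<close>

definition unit_of_presentation :: "'a::complex_algebra \<Rightarrow> 'a presentation \<Rightarrow> bool" where
  "unit_of_presentation e p \<longleftrightarrow> central_idempotent e \<and>
     (\<forall>(a, g, b) \<in> set p. e * a = a \<and> a * e = a \<and> e * b = b \<and> b * e = b)"

lemma supported_by_presented:
  assumes "is_presentation p" "unit_of_presentation e p"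
  shows "supported_by e (presented p)"
proof -
  have "presented p (e * y) = presented p y" for y
    unfolding presented_def
  proof (intro arg_cong[of _ _ sum_list] map_cong refl)
    fix t assume t: "t \<in> set p"
    obtain a g b where "t = (a, g, b)" by (cases t)
    then show "(case t of (a, g, b) \<Rightarrow> g (b * (e * y) * a)) = (case t of (a, g, b) \<Rightarrow> g (b * y * a))"
      using t assms(2) by (auto simp: unit_of_presentation_def mult.assoc[symmetric])
  qed
  then show ?thesis
    using assms clinear_presented by (auto simp: supported_by_def unit_of_presentation_def)
qed

lemma unit_of_presentation_exists:
  fixes p :: "'a::complex_algebra presentation"
  assumes "central_local_units TYPE('a)"
  obtains e where "unit_of_presentation e p"
proof -
  define S where "S = (\<lambda>(a, g, b). a) ` set p \<union> (\<lambda>(a, g, b). b) ` set p"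
  have S: "finite S" by (simp add: S_def)
  obtain e where e: "central_idempotent e" "\<And>x. x \<in> S \<Longrightarrow> e * x = x" "\<And>x. x \<in> S \<Longrightarrow> x * e = x"
    by (rule common_central_unit[OF assms S], rule that)
  show thesis
  proof (rule that[of e], unfold unit_of_presentation_def, intro conjI e(1) ballI, clarify)
    fix a g b assume "(a, g, b) \<in> set p"
    then have "a \<in> S" "b \<in> S" by (force simp: S_def)+
    then show "e * a = a \<and> a * e = a \<and> e * b = b \<and> b * e = b" using e(2,3) by blast
  qed
qed

lemma reduced_if_supported: "supported_by e \<xi> \<Longrightarrow> \<xi> \<in> reduced_functionals"
proof -
  assume e: "supported_by e \<xi>"
  have "presented [(e, \<xi>, e)] = \<xi>"
    using e supported_by_right[OF e] by (auto simp: presented_def supported_by_def mult.assoc)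
  moreover have "is_presentation [(e, \<xi>, e)]" using e by (simp add: is_presentation_def supported_by_def)
  ultimately show ?thesis unfolding reduced_functionals_def by (metis imageI mem_Collect_eq)
qed

lemma reduced_iff_supported:
  fixes \<xi> :: "'a::complex_algebra \<Rightarrow> complex"
  assumes "central_local_units TYPE('a)"
  shows "\<xi> \<in> reduced_functionals \<longleftrightarrow> (\<exists>e. supported_by e \<xi>)"
proof
  assume "\<xi> \<in> reduced_functionals"
  then obtain p where p: "is_presentation p" "\<xi> = presented p" by (auto simp: reduced_functionals_def)
  obtain e where "unit_of_presentation e p" by (rule unit_of_presentation_exists[OF assms])
  then show "\<exists>e. supported_by e \<xi>" using p supported_by_presented by blast
qed (auto intro: reduced_if_supported)

lemma supported_by_translates:
  assumes e: "central_idempotent e" "e * a = a" and g: "clinear g"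
  shows "supported_by e (\<lambda>y. g (y * a))" "supported_by e (\<lambda>y. g (a * y))"
proof -
  have c: "y * e = e * y" for y using e(1) by (simp add: central_idempotent_def)
  have "e * y * a = y * a" "a * (e * y) = a * y" for y
    using c e(2) by (metis mult.assoc)+
  then show "supported_by e (\<lambda>y. g (y * a))" "supported_by e (\<lambda>y. g (a * y))"
    using e clinear_compose[OF g clinear_times_right] clinear_compose[OF g clinear_times_left]
    by (auto simp: supported_by_def)
qed

lemma injective_endomorphism_surj:
  fixes B :: "'v::complex_vector set"
  assumes B: "finite B" "cvec.independent B" and L: "clinear L" "L ` B \<subseteq> cvec.span B"
    and inj: "\<And>a. a \<in> cvec.span B \<Longrightarrow> L a = 0 \<Longrightarrow> a = 0" and v: "v \<in> cvec.span B"
  obtains a where "a \<in> cvec.span B" "L a = v"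
proof -
  interpret L: Vector_Spaces.linear "(*\<^sub>C)" "(*\<^sub>C)" L by (rule L(1))
  have inj: "inj_on L (cvec.span B)"
  proof (rule inj_onI)
    fix x y assume "x \<in> cvec.span B" "y \<in> cvec.span B" "L x = L y"
    then show "x = y" using inj[of "x - y"] by (simp add: cvec.span_diff L.diff)
  qed
  have ind: "cvec.independent (L ` B)" by (rule L.independent_injective_image[OF B(2) inj])
  have card: "card (L ` B) = card B"
    using inj_on_subset[OF inj cvec.span_superset] by (rule card_image)
  have "v \<in> cvec.span (L ` B)"
  proof (rule ccontr)
    assume nv: "v \<notin> cvec.span (L ` B)"
    then have "cvec.independent (insert v (L ` B))" using ind by (rule cvec.independent_insertI)
    moreover have "insert v (L ` B) \<subseteq> cvec.span B" using v L(2) by simp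
    ultimately have "card (insert v (L ` B)) \<le> card B"
      using cvec.independent_span_bound[OF B(1)] by blast
    moreover have "v \<notin> L ` B" using nv cvec.span_base by blast
    ultimately show False using B(1) card by simp
  qed
  then show thesis using that by (auto simp: L.span_image)
qed

text \<open>On a finite dimensional ideal \<open>e \<A>\<close> the map \<open>a \<mapsto> (x \<mapsto> \<phi> (x * a))\<close> into the dual space is
  injective by faithfulness, hence surjective. It is written as the endomorphism
  \<open>L a = \<Sum>b\<in>B. \<phi> (b * a) b\<close> of \<open>e \<A>\<close> for a basis \<open>B\<close>.\<close>

lemma dual_space_eq_reduced:
  fixes \<delta> :: "'a::complex_algebra \<Rightarrow> ('a \<otimes> 'a) multiplier"
  assumes hopf: "multiplier_hopf_algebra \<delta>" and sum: "direct_sum_of_matrix_algebras TYPE('a)"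
    and units: "central_local_units TYPE('a)"
    and inv: "left_invariant \<delta> \<phi>" and nz: "\<phi> \<noteq> (\<lambda>_. 0)"
  shows "dual_space \<phi> = reduced_functionals"
proof
  have \<phi>: "clinear \<phi>" using inv by (simp add: left_invariant_def)
  show "dual_space \<phi> \<subseteq> reduced_functionals"
  proof
    fix \<xi> assume "\<xi> \<in> dual_space \<phi>"
    then obtain a where \<xi>: "\<xi> = (\<lambda>b. \<phi> (b * a))" by (auto simp: dual_space_def)
    obtain e where e: "central_idempotent e" "e * a = a"
      using common_central_unit[OF units, of "{a}"] by auto
    show "\<xi> \<in> reduced_functionals"
      unfolding \<xi> by (rule reduced_if_supported[OF supported_by_translates(1)[OF e \<phi>]])
  qed
  show "reduced_functionals \<subseteq> dual_space \<phi>"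
  proof
    fix f :: "'a \<Rightarrow> complex" assume "f \<in> reduced_functionals"
    then obtain e0 where e0: "supported_by e0 f" using reduced_iff_supported[OF units] by blast
    obtain e where e: "central_idempotent e" "finite_dimensional (range ((*) e))" "e * e0 = e0"
      using common_central_unit[OF units, of "{e0}"] by auto
    have f: "clinear f" "\<And>y. f (e * y) = f y"
      using supported_by_mono[OF e0 e(1,3)] by (auto simp: supported_by_def)
    obtain B u where B: "finite B" "cvec.independent B" "B \<subseteq> range ((*) e)"
      and u: "\<And>x. e * x = (\<Sum>b\<in>B. u b x *\<^sub>C b)"
      by (rule finite_dimensional_coordinates[OF e(2)], rule that)
    define L where "L = (\<lambda>a. \<Sum>b\<in>B. \<phi> (b * a) *\<^sub>C b)"
    have L: "clinear L"
      by (intro clinearI) (simp_all add: L_def distrib_left clinear_add[OF \<phi>] scaleC_add_left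
          sum.distrib mult_scaleC_right clinear_scaleC[OF \<phi>] scaleC_complex cvec.scale_sum_right scaleC_scaleC)
    have "e * (e * x) = e * x" for x
      using e(1) unfolding central_idempotent_def by (metis mult.assoc)
    then have "B \<subseteq> {a. e * a = a}" using B(3) by force
    moreover have "cvec.subspace {a. e * a = a}"
      by (rule cvec.subspaceI) (simp_all add: distrib_left mult_scaleC_right)
    ultimately have "cvec.span B \<subseteq> {a. e * a = a}" by (rule cvec.span_minimal)
    then have eB: "e * a = a" if "a \<in> cvec.span B" for a using that by blast
    have via: "\<phi> (x * a) = (\<Sum>b\<in>B. u b x * \<phi> (b * a))" if "a \<in> cvec.span B" for x a
    proof -
      have "x * a = e * x * a"
        using eB[OF that] e(1) by (metis central_idempotent_def mult.assoc)
      then show ?thesis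
        by (simp add: u sum_distrib_right mult_scaleC_left clinear_sum[OF \<phi>] clinear_scaleC[OF \<phi>] scaleC_complex)
    qed
    have "(\<Sum>b\<in>B. f b *\<^sub>C b) \<in> cvec.span B"
      by (intro cvec.span_sum cvec.span_scale cvec.span_base)
    moreover have "L a \<in> cvec.span B" for a
      unfolding L_def by (intro cvec.span_sum cvec.span_scale cvec.span_base)
    then have "L ` B \<subseteq> cvec.span B" by blast
    moreover have "a = 0" if a: "a \<in> cvec.span B" "L a = 0" for a
    proof (rule left_invariant_faithful[OF hopf sum inv nz])
      have "\<phi> (b * a) = 0" if "b \<in> B" for b
        using cvec.independentD[OF B(2,1) subset_refl a(2)[unfolded L_def] that] .
      then show "\<phi> (x * a) = 0" for x unfolding via[OF a(1), of x] by simp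
    qed
    ultimately obtain a where a: "a \<in> cvec.span B" "L a = (\<Sum>b\<in>B. f b *\<^sub>C b)"
      using injective_endomorphism_surj[OF B(1,2) L, of "\<Sum>b\<in>B. f b *\<^sub>C b"] by blast
    have "(\<Sum>b\<in>B. (\<phi> (b * a) - f b) *\<^sub>C b) = 0"
      using a(2) by (simp add: L_def cvec.scale_left_diff_distrib sum_subtractf)
    from cvec.independentD[OF B(2,1) subset_refl this]
    have fb: "\<phi> (b * a) = f b" if "b \<in> B" for b using that by simp
    have "f x = \<phi> (x * a)" for x
    proof -
      have "f x = f (e * x)" by (simp add: f)
      also have "\<dots> = (\<Sum>b\<in>B. u b x * f b)"
        by (simp add: u clinear_sum[OF f(1)] clinear_scaleC[OF f(1)] scaleC_complex)
      also have "\<dots> = \<phi> (x * a)" unfolding via[OF a(1), of x] by (simp add: fb)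
      finally show ?thesis .
    qed
    then show "f \<in> dual_space \<phi>" by (auto simp: dual_space_def)
  qed
qed


section \<open>Slices of multipliers\<close>

lemma multiplier_from_pair:
  assumes "clinear l" "clinear r" "\<And>a b. r a * b = a * l b"
  obtains m where "\<And>a. m \<rhd> a = l a" "\<And>a. a \<lhd> m = r a"
proof -
  have "(l, r) \<in> {(l, r) |l r. clinear l \<and> clinear r \<and> (\<forall>a b. r a * b = a * l b)}"
    using assms by blast
  from Abs_multiplier_inverse[OF this] show thesis
    by (intro that[of "Abs_multiplier (l, r)"]) (simp_all add: mult_left.rep_eq mult_right.rep_eq)
qed

lemma tensor_map_right_times:
  fixes s t :: "'b::complex_algebra \<otimes> 'a::complex_algebra"
  shows "tensor_map id (\<lambda>z. z * a) (s * t) = s * tensor_map id (\<lambda>z. z * a) t"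
proof (induction s rule: tensor_induct)
  case (tens x y)
  show ?case
    by (induction t rule: tensor_induct)
      (simp_all add: tensor_map_tens tensor_map_add id_def clinear_id[unfolded id_def] clinear_times_right
        distrib_left tens_times_tens mult.assoc)
qed (simp add: tensor_map_add id_def clinear_id[unfolded id_def] clinear_times_right distrib_right)

lemma tensor_map_left_times:
  fixes s t :: "'b::complex_algebra \<otimes> 'a::complex_algebra"
  shows "tensor_map id ((*) a) (s * t) = tensor_map id ((*) a) s * t"
proof (induction s rule: tensor_induct)
  case (tens x y)
  show ?case
    by (induction t rule: tensor_induct)
      (simp_all add: tensor_map_tens tensor_map_add id_def clinear_id[unfolded id_def] clinear_times_left
        distrib_left tens_times_tens mult.assoc)
qed (simp add: tensor_map_add id_def clinear_id[unfolded id_def] clinear_times_left distrib_right)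

lemma mult_left_tensor_map:
  fixes Y :: "('b::complex_algebra \<otimes> 'a::complex_algebra) multiplier"
  assumes "nondegenerate_product TYPE('b \<otimes> 'a)"
  shows "Y \<rhd> tensor_map id (\<lambda>z. z * a) t = tensor_map id (\<lambda>z. z * a) (Y \<rhd> t)"
  by (rule nondegenerate_left[OF assms])
    (simp add: multiplier_balanced[symmetric] tensor_map_right_times[symmetric])

lemma mult_right_tensor_map:
  fixes Y :: "('b::complex_algebra \<otimes> 'a::complex_algebra) multiplier"
  assumes "nondegenerate_product TYPE('b \<otimes> 'a)"
  shows "tensor_map id ((*) a) t \<lhd> Y = tensor_map id ((*) a) (t \<lhd> Y)"
  by (rule nondegenerate_right[OF assms])
    (simp add: multiplier_balanced tensor_map_left_times[symmetric])

lemma tensor_functional_eq: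
  assumes f: "clinear f" and g: "clinear g"
  shows "tensor_functional f g t = f (id_tensor_functional g t)"
proof -
  have bil: "cbilinear (\<lambda>b a. f b * g a)"
    by (intro bilinearI)
      (simp_all add: clinear_add[OF f] clinear_add[OF g] clinear_scaleC[OF f] clinear_scaleC[OF g]
        scaleC_complex algebra_simps)
  show ?thesis
    unfolding tensor_functional_def
    by (induction t rule: tensor_induct)
      (simp_all add: tensor_lift_tens[OF bil] tensor_lift_add[OF bil] id_tensor_tens[OF g]
        id_tensor_add[OF g] clinear_add[OF f] clinear_scaleC[OF f] scaleC_complex)
qed

lemma id_tensor_presented:
  fixes t :: "'b::complex_algebra \<otimes> 'a::complex_algebra"
  assumes "is_presentation p" and f: "clinear f"
  shows "(\<Sum>(a, g, a') \<leftarrow> p. f (b' * id_tensor_functional (\<lambda>y. g (a' * (y * a))) t)) =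
    f (b' * id_tensor_functional (presented p) t)"
  using assms(1)
proof (induction p)
  case Nil
  have lin: "clinear (\<lambda>_::'a. 0::complex)" by (intro clinearI) simp_all
  have "id_tensor_functional (\<lambda>_. 0) t = 0"
    by (induction t rule: tensor_induct) (simp_all add: id_tensor_tens lin id_tensor_add)
  moreover have "presented [] = (\<lambda>_::'a. 0)" by (simp add: presented_def fun_eq_iff)
  ultimately show ?case by (simp add: clinear_zero[OF f])
next
  case (Cons s p)
  obtain a g a' where s: "s = (a, g, a')" by (cases s)
  have p: "is_presentation p" and g: "clinear g" using Cons.prems by (auto simp: s is_presentation_def)
  have g': "clinear (\<lambda>y. g (a' * (y * a)))"
    by (rule clinear_compose[OF g clinear_compose[OF clinear_times_left clinear_times_right]])
  have "presented (s # p) = (\<lambda>y. g (a' * (y * a)) + presented p y)"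
    by (auto simp: s presented_def mult.assoc)
  then show ?case
    using Cons.IH[OF p]
    by (simp add: s id_tensor_add_functional[OF g' clinear_presented[OF p]] distrib_left clinear_add[OF f])
qed

lemma extension_tensor_presentation:
  "extension (tensor_presentation q p) Y =
    (\<Sum>(b, f, b') \<leftarrow> q. \<Sum>(a, g, a') \<leftarrow> p. tensor_functional f g ((b' \<otimes>\<^sub>t a') * (Y \<rhd> (b \<otimes>\<^sub>t a))))"
proof (induction q)
  case Nil
  show ?case by (simp add: extension_def tensor_presentation_def)
next
  case (Cons s q)
  obtain b f b' where s: "s = (b, f, b')" by (cases s)
  have "(\<Sum>(a, f, b) \<leftarrow> map (\<lambda>(a, g, a'). (b \<otimes>\<^sub>t a, tensor_functional f g, b' \<otimes>\<^sub>t a')) p. f (b * (Y \<rhd> a))) =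
    (\<Sum>(a, g, a') \<leftarrow> p. tensor_functional f g ((b' \<otimes>\<^sub>t a') * (Y \<rhd> (b \<otimes>\<^sub>t a))))"
    by (induction p) auto
  then show ?case using Cons by (simp add: s extension_def tensor_presentation_def)
qed

text \<open>The unit \<open>e\<close> lets \<open>Y (b \<otimes> a)\<close> be replaced by \<open>Y (b \<otimes> e)(I \<otimes> a)\<close>, so that the extension of \<open>\<zeta> \<otimes> \<xi>\<close>
  depends on the presentation of \<open>\<xi>\<close> only through \<open>\<xi>\<close> and \<open>e\<close>.\<close>

lemma extension_slice:
  fixes Y :: "('b::complex_algebra \<otimes> 'a::complex_algebra) multiplier"
  assumes nd: "nondegenerate_product TYPE('b \<otimes> 'a)"
    and q: "is_presentation q" and p: "is_presentation p" and e: "unit_of_presentation e p"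
    and m: "\<And>b. m \<rhd> b = id_tensor_functional (presented p) (Y \<rhd> (b \<otimes>\<^sub>t e))"
  shows "extension (tensor_presentation q p) Y = extension q m"
  unfolding extension_tensor_presentation unfolding extension_def
proof (intro arg_cong[of _ _ sum_list] map_cong refl)
  fix s assume s: "s \<in> set q"
  obtain b f b' where s': "s = (b, f, b')" by (cases s)
  have f: "clinear f" using q s by (auto simp: s' is_presentation_def)
  have "(\<Sum>(a, g, a') \<leftarrow> p. tensor_functional f g ((b' \<otimes>\<^sub>t a') * (Y \<rhd> (b \<otimes>\<^sub>t a)))) =
    (\<Sum>(a, g, a') \<leftarrow> p. f (b' * id_tensor_functional (\<lambda>y. g (a' * (y * a))) (Y \<rhd> (b \<otimes>\<^sub>t e))))"
  proof (intro arg_cong[of _ _ sum_list] map_cong refl)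
    fix t assume t: "t \<in> set p"
    obtain a g a' where t': "t = (a, g, a')" by (cases t)
    have g: "clinear g" and ea: "e * a = a"
      using p e t by (auto simp: t' is_presentation_def unit_of_presentation_def)
    have "Y \<rhd> (b \<otimes>\<^sub>t a) = tensor_map id (\<lambda>z. z * a) (Y \<rhd> (b \<otimes>\<^sub>t e))"
      using mult_left_tensor_map[OF nd, of Y a "b \<otimes>\<^sub>t e"]
      by (simp add: tensor_map_tens clinear_id clinear_times_right ea)
    then have "tensor_functional f g ((b' \<otimes>\<^sub>t a') * (Y \<rhd> (b \<otimes>\<^sub>t a))) =
      f (b' * id_tensor_functional (\<lambda>y. g (a' * (y * a))) (Y \<rhd> (b \<otimes>\<^sub>t e)))"
      by (simp add: tensor_functional_eq[OF f g] id_tensor_times_left[OF g]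
          id_tensor_map_right[OF clinear_times_right clinear_compose[OF g clinear_times_left]])
    then show "(case t of (a, g, a') \<Rightarrow> tensor_functional f g ((b' \<otimes>\<^sub>t a') * (Y \<rhd> (b \<otimes>\<^sub>t a)))) =
      (case t of (a, g, a') \<Rightarrow> f (b' * id_tensor_functional (\<lambda>y. g (a' * (y * a))) (Y \<rhd> (b \<otimes>\<^sub>t e))))"
      by (simp add: t')
  qed
  also have "\<dots> = f (b' * (m \<rhd> b))" by (simp add: id_tensor_presented[OF p f] m)
  finally show "(case s of (b, f, b') \<Rightarrow> \<Sum>(a, g, a') \<leftarrow> p. tensor_functional f g ((b' \<otimes>\<^sub>t a') * (Y \<rhd> (b \<otimes>\<^sub>t a)))) =
    (case s of (a, f, b) \<Rightarrow> f (b * (m \<rhd> a)))" by (simp add: s')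
qed

lemma extension_separates:
  fixes m m' :: "'b::complex_algebra multiplier"
  assumes nd: "nondegenerate_product TYPE('b)"
    and ext: "\<And>q. is_presentation q \<Longrightarrow> extension q m = extension q m'"
  shows "m = m'"
proof (rule multiplier_eqI)
  show left: "m \<rhd> b = m' \<rhd> b" for b
  proof (rule nondegenerate_left[OF nd], rule eq_if_functionals_eq)
    fix b' and f :: "'b \<Rightarrow> complex" assume "clinear f"
    then show "f (b' * (m \<rhd> b)) = f (b' * (m' \<rhd> b))"
      using ext[of "[(b, f, b')]"] by (simp add: is_presentation_def extension_def)
  qed
  show "b \<lhd> m = b \<lhd> m'" for b
    by (rule nondegenerate_right[OF nd]) (simp add: multiplier_balanced left)
qed

text \<open>The right-hand sides of the two equations define a multiplier because \<open>\<xi> (e y) = \<xi> y = \<xi> (y e)\<close>,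
  and this multiplier satisfies the defining equation of the slice for every presentation of \<open>\<xi>\<close>.\<close>

lemma slice_formula:
  fixes Y :: "('b::complex_algebra \<otimes> 'a::complex_algebra) multiplier"
  assumes B: "nondegenerate_product TYPE('b)" and A: "nondegenerate_product TYPE('a)"
    and units: "central_local_units TYPE('a)" and e: "supported_by e \<xi>"
  shows "slice Y \<xi> \<rhd> b = id_tensor_functional \<xi> (Y \<rhd> (b \<otimes>\<^sub>t e))"
    and "b \<lhd> slice Y \<xi> = id_tensor_functional \<xi> ((b \<otimes>\<^sub>t e) \<lhd> Y)"
proof -
  have nd: "nondegenerate_product TYPE('b \<otimes> 'a)" by (rule nondegenerate_tensor[OF B A])
  have ex: "\<exists>m. (\<forall>b. m \<rhd> b = id_tensor_functional \<xi> (Y \<rhd> (b \<otimes>\<^sub>t e))) \<and>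
      (\<forall>b. b \<lhd> m = id_tensor_functional \<xi> ((b \<otimes>\<^sub>t e) \<lhd> Y))" if e: "supported_by e \<xi>" for e
  proof -
    have \<xi>: "clinear \<xi>" "(\<lambda>y. \<xi> (e * y)) = \<xi>" "(\<lambda>y. \<xi> (y * e)) = \<xi>"
      using e supported_by_right[OF e] by (auto simp: supported_by_def)
    have te: "clinear (\<lambda>b::'b. b \<otimes>\<^sub>t e)" by (intro clinearI) (simp_all add: tens_add_left tens_scaleC_left)
    show ?thesis
    proof (rule multiplier_from_pair)
      show "clinear (\<lambda>b. id_tensor_functional \<xi> (Y \<rhd> (b \<otimes>\<^sub>t e)))"
        by (rule clinear_compose[OF clinear_id_tensor[OF \<xi>(1)] clinear_compose[OF clinear_mult_left te]])
      show "clinear (\<lambda>b. id_tensor_functional \<xi> ((b \<otimes>\<^sub>t e) \<lhd> Y))"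
        by (rule clinear_compose[OF clinear_id_tensor[OF \<xi>(1)] clinear_compose[OF clinear_mult_right te]])
      show "id_tensor_functional \<xi> ((b' \<otimes>\<^sub>t e) \<lhd> Y) * b = b' * id_tensor_functional \<xi> (Y \<rhd> (b \<otimes>\<^sub>t e))"
        for b' b
        using id_tensor_times_right[OF \<xi>(1), of "(b' \<otimes>\<^sub>t e) \<lhd> Y" b e]
          id_tensor_times_left[OF \<xi>(1), of b' e "Y \<rhd> (b \<otimes>\<^sub>t e)"]
        by (simp add: \<xi> multiplier_balanced)
    qed blast
  qed
  obtain m where m: "\<And>b. m \<rhd> b = id_tensor_functional \<xi> (Y \<rhd> (b \<otimes>\<^sub>t e))"
    "\<And>b. b \<lhd> m = id_tensor_functional \<xi> ((b \<otimes>\<^sub>t e) \<lhd> Y)"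
    using ex[OF e] by blast
  let ?p = "[(e, \<xi>, e)]"
  have ce: "central_idempotent e" "e * e = e" using e unfolding supported_by_def central_idempotent_def by blast+
  have p: "is_presentation ?p" "presented ?p = \<xi>" "unit_of_presentation e ?p"
    using e ce supported_by_right[OF e]
    by (auto simp: is_presentation_def presented_def supported_by_def unit_of_presentation_def mult.assoc)
  have ext_p: "extension (tensor_presentation q ?p) Y = extension q m" if "is_presentation q" for q
    by (rule extension_slice[OF nd that p(1,3)]) (simp only: p(2) m)
  \<comment> \<open>A common unit of two presentations of \<open>\<xi>\<close> shows that they give the same extension.\<close>
  have ext: "extension (tensor_presentation q p') Y = extension q m"
    if q: "is_presentation q" and p': "is_presentation p'" "presented p' = \<xi>" for q p'
  proof -
    obtain e' where "unit_of_presentation e' (?p @ p')" by (rule unit_of_presentation_exists[OF units])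
    then have e': "unit_of_presentation e' ?p" "unit_of_presentation e' p'"
      by (simp_all add: unit_of_presentation_def)
    have "supported_by e' \<xi>" using supported_by_presented[OF p(1) e'(1)] p(2) by simp
    then obtain m' where m': "\<And>b. m' \<rhd> b = id_tensor_functional \<xi> (Y \<rhd> (b \<otimes>\<^sub>t e'))" using ex by blast
    have "extension (tensor_presentation q p') Y = extension q m'"
      by (rule extension_slice[OF nd q p'(1) e'(2)]) (simp only: p'(2) m')
    also have "\<dots> = extension (tensor_presentation q ?p) Y"
      by (rule extension_slice[OF nd q p(1) e'(1), symmetric]) (simp only: p(2) m')
    finally show ?thesis by (simp add: ext_p[OF q])
  qed
  have "slice Y \<xi> = m"
    unfolding slice_def
  proof (rule the_equality)
    show "is_slice Y \<xi> m"
      unfolding is_slice_def using ext reduced_if_supported[OF e] by blast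
    fix m' assume "is_slice Y \<xi> m'"
    then have "extension q m' = extension q m" if "is_presentation q" for q
      unfolding is_slice_def using that p(1,2) ext_p by metis
    then show "m' = m" by (rule extension_separates[OF B])
  qed
  then show "slice Y \<xi> \<rhd> b = id_tensor_functional \<xi> (Y \<rhd> (b \<otimes>\<^sub>t e))"
    "b \<lhd> slice Y \<xi> = id_tensor_functional \<xi> ((b \<otimes>\<^sub>t e) \<lhd> Y)" by (simp_all add: m)
qed

text \<open>For the functionals \<open>y \<mapsto> g (y a)\<close> and \<open>y \<mapsto> g (a y)\<close>, with \<open>g\<close> an arbitrary functional, the
  local unit disappears from the formula. These slices determine \<open>Y\<close>.\<close>

lemma slice_translate:
  fixes Y :: "('b::complex_algebra \<otimes> 'a::complex_algebra) multiplier"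
  assumes B: "nondegenerate_product TYPE('b)" and A: "nondegenerate_product TYPE('a)"
    and units: "central_local_units TYPE('a)" and g: "clinear g"
  shows "slice Y (\<lambda>y. g (y * a)) \<rhd> b = id_tensor_functional g (Y \<rhd> (b \<otimes>\<^sub>t a))"
    and "b \<lhd> slice Y (\<lambda>y. g (a * y)) = id_tensor_functional g ((b \<otimes>\<^sub>t a) \<lhd> Y)"
proof -
  have nd: "nondegenerate_product TYPE('b \<otimes> 'a)" by (rule nondegenerate_tensor[OF B A])
  obtain e where e: "central_idempotent e" "e * a = a" "a * e = a"
    using common_central_unit[OF units, of "{a}"] by auto
  note sup = supported_by_translates[OF e(1,2) g]
  have "slice Y (\<lambda>y. g (y * a)) \<rhd> b = id_tensor_functional g (Y \<rhd> tensor_map id (\<lambda>z. z * a) (b \<otimes>\<^sub>t e))"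
    by (simp add: slice_formula(1)[OF B A units sup(1)] mult_left_tensor_map[OF nd]
        id_tensor_map_right[OF clinear_times_right g])
  then show "slice Y (\<lambda>y. g (y * a)) \<rhd> b = id_tensor_functional g (Y \<rhd> (b \<otimes>\<^sub>t a))"
    by (simp add: tensor_map_tens clinear_id clinear_times_right e)
  have "b \<lhd> slice Y (\<lambda>y. g (a * y)) = id_tensor_functional g (tensor_map id ((*) a) (b \<otimes>\<^sub>t e) \<lhd> Y)"
    by (simp add: slice_formula(2)[OF B A units sup(2)] mult_right_tensor_map[OF nd]
        id_tensor_map_right[OF clinear_times_left g])
  then show "b \<lhd> slice Y (\<lambda>y. g (a * y)) = id_tensor_functional g ((b \<otimes>\<^sub>t a) \<lhd> Y)"
    by (simp add: tensor_map_tens clinear_id clinear_times_left e)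
qed

lemma translates_reduced:
  fixes g :: "'a::complex_algebra \<Rightarrow> complex"
  assumes units: "central_local_units TYPE('a)" and g: "clinear g"
  shows "(\<lambda>y. g (y * a)) \<in> reduced_functionals" "(\<lambda>y. g (a * y)) \<in> reduced_functionals"
proof -
  obtain e where "central_idempotent e" "e * a = a"
    using common_central_unit[OF units, of "{a}"] by auto
  from supported_by_translates[OF this g] show
    "(\<lambda>y. g (y * a)) \<in> reduced_functionals" "(\<lambda>y. g (a * y)) \<in> reduced_functionals"
    by (auto intro: reduced_if_supported)
qed

lemma common_support:
  fixes \<xi> \<eta> :: "'a::complex_algebra \<Rightarrow> complex"
  assumes units: "central_local_units TYPE('a)"
    and "\<xi> \<in> reduced_functionals" "\<eta> \<in> reduced_functionals"
  obtains e where "supported_by e \<xi>" "supported_by e \<eta>" "supported_by e (\<lambda>y. \<xi> y + \<eta> y)"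
proof -
  obtain e1 e2 where e12: "supported_by e1 \<xi>" "supported_by e2 \<eta>"
    using assms reduced_iff_supported[OF units] by blast
  obtain e where e: "central_idempotent e" "e * e1 = e1" "e * e2 = e2"
    using common_central_unit[OF units, of "{e1, e2}"] by (metis finite.emptyI finite.insertI insertCI)
  have s: "supported_by e \<xi>" "supported_by e \<eta>" using e12 e supported_by_mono by blast+
  then have "supported_by e (\<lambda>y. \<xi> y + \<eta> y)"
    by (auto simp: supported_by_def clinear_iff scaleC_add_right)
  then show thesis using s that by blast
qed

lemma supported_by_scale: "supported_by e \<xi> \<Longrightarrow> supported_by e (\<lambda>y. k * \<xi> y)"
  by (auto simp: supported_by_def clinear_iff scaleC_complex distrib_left)

lemma reduced_add:
  fixes \<xi> :: "'a::complex_algebra \<Rightarrow> complex"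
  assumes "central_local_units TYPE('a)" "\<xi> \<in> reduced_functionals" "\<eta> \<in> reduced_functionals"
  shows "(\<lambda>y. \<xi> y + \<eta> y) \<in> reduced_functionals"
  using common_support[OF assms] reduced_if_supported by blast

lemma reduced_scale:
  fixes \<xi> :: "'a::complex_algebra \<Rightarrow> complex"
  assumes "central_local_units TYPE('a)" "\<xi> \<in> reduced_functionals"
  shows "(\<lambda>y. k * \<xi> y) \<in> reduced_functionals"
  using assms reduced_iff_supported supported_by_scale by blast

lemma slice_linear:
  fixes Y :: "('b::complex_algebra \<otimes> 'a::complex_algebra) multiplier"
  assumes B: "nondegenerate_product TYPE('b)" and A: "nondegenerate_product TYPE('a)"
    and units: "central_local_units TYPE('a)" and \<xi>: "\<xi> \<in> reduced_functionals"
  shows "\<eta> \<in> reduced_functionals \<Longrightarrow> slice Y (\<lambda>y. \<xi> y + \<eta> y) = slice Y \<xi> + slice Y \<eta>"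
    and "slice Y (\<lambda>y. k * \<xi> y) = k *\<^sub>C slice Y \<xi>"
    and "slice (X + Y) \<xi> = slice X \<xi> + slice Y \<xi>"
proof -
  note F = slice_formula[OF B A units]
  obtain e where e: "supported_by e \<xi>" using \<xi> reduced_iff_supported[OF units] by blast
  note \<xi>_lin = supported_by_clinear[OF e]
  show "slice Y (\<lambda>y. k * \<xi> y) = k *\<^sub>C slice Y \<xi>"
    by (rule multiplier_eqI)
      (simp_all add: F[OF e] F[OF supported_by_scale[OF e]] mult_left_scaleC mult_right_scaleC
        id_tensor_scale_functional[OF \<xi>_lin])
  show "slice (X + Y) \<xi> = slice X \<xi> + slice Y \<xi>"
    by (rule multiplier_eqI)
      (simp_all add: F[OF e] mult_left_add mult_right_add id_tensor_add[OF \<xi>_lin])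
  show "slice Y (\<lambda>y. \<xi> y + \<eta> y) = slice Y \<xi> + slice Y \<eta>" if \<eta>: "\<eta> \<in> reduced_functionals"
  proof -
    obtain e where e: "supported_by e \<xi>" "supported_by e \<eta>" "supported_by e (\<lambda>y. \<xi> y + \<eta> y)"
      by (rule common_support[OF units \<xi> \<eta>])
    show ?thesis
      by (rule multiplier_eqI)
        (simp_all add: F[OF e(1)] F[OF e(2)] F[OF e(3)] mult_left_add mult_right_add
          id_tensor_add_functional[OF supported_by_clinear[OF e(1)] supported_by_clinear[OF e(2)]])
  qed
qed

lemma slice_multiplier_tens:
  fixes m :: "'b::complex_algebra multiplier" and n :: "'a::complex_algebra multiplier"
  assumes B: "nondegenerate_product TYPE('b)" and A: "nondegenerate_product TYPE('a)"
    and units: "central_local_units TYPE('a)" and \<xi>: "\<xi> \<in> reduced_functionals"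
  obtains k where "slice (multiplier_tens m n) \<xi> = k *\<^sub>C m"
proof -
  obtain e where e: "supported_by e \<xi>" using \<xi> reduced_iff_supported[OF units] by blast
  have "\<xi> (n \<rhd> e) = \<xi> (e * (n \<rhd> e))" using e by (simp add: supported_by_def)
  also have "\<dots> = \<xi> (e \<lhd> n)"
    using supported_by_right[OF e] by (simp add: multiplier_balanced[symmetric])
  finally have "\<xi> (n \<rhd> e) = \<xi> (e \<lhd> n)" .
  then have "slice (multiplier_tens m n) \<xi> = \<xi> (n \<rhd> e) *\<^sub>C m"
    by (intro multiplier_eqI)
      (simp_all add: slice_formula[OF B A units e] multiplier_tens_left_tens multiplier_tens_right_tens
        id_tensor_tens supported_by_clinear[OF e] mult_left_scaleC mult_right_scaleC)
  then show thesis by (rule that)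
qed


section \<open>Multipliers with finite dimensional space of slices\<close>

lemma finite_dimensional_slices_embed:
  fixes T :: "'b::complex_algebra multiplier \<otimes> 'a::complex_algebra multiplier"
  assumes B: "nondegenerate_product TYPE('b)" and A: "nondegenerate_product TYPE('a)"
    and units: "central_local_units TYPE('a)"
  shows "\<exists>S. finite S \<and> (\<forall>\<xi>\<in>reduced_functionals. slice (multiplier_embed T) \<xi> \<in> cvec.span S)"
proof (induction T rule: tensor_induct)
  case (tens m n)
  have "slice (multiplier_tens m n) \<xi> \<in> cvec.span {m}" if "\<xi> \<in> reduced_functionals" for \<xi>
    using slice_multiplier_tens[OF B A units that, of m n] cvec.span_scale cvec.span_base
    by (metis singletonI)
  then show ?case by (intro exI[of _ "{m}"]) (auto simp: multiplier_embed_tens)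
next
  case (add s t)
  then obtain S T where S: "finite S" "finite T"
    "\<And>\<xi>. \<xi> \<in> reduced_functionals \<Longrightarrow> slice (multiplier_embed s) \<xi> \<in> cvec.span S"
    "\<And>\<xi>. \<xi> \<in> reduced_functionals \<Longrightarrow> slice (multiplier_embed t) \<xi> \<in> cvec.span T" by blast
  have add: "multiplier_embed (s + t) = multiplier_embed s + multiplier_embed t"
    by (simp add: multiplier_embed_def tensor_lift_add[OF bilinear_multiplier_tens])
  have sub: "cvec.span S \<subseteq> cvec.span (S \<union> T)" "cvec.span T \<subseteq> cvec.span (S \<union> T)"
    by (intro cvec.span_mono; simp)+
  have "slice (multiplier_embed (s + t)) \<xi> \<in> cvec.span (S \<union> T)" if "\<xi> \<in> reduced_functionals" for \<xi>
    unfolding add slice_linear(3)[OF B A units that]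
    using S(3,4)[OF that] sub by (intro cvec.span_add) auto
  then show ?case using S(1,2) by (intro exI[of _ "S \<union> T"]) auto
qed

text \<open>A linear form \<open>\<Lambda>\<close> on the reduced functionals is evaluation at a multiplier: for fixed \<open>a\<close>, the
  form \<open>g \<mapsto> \<Lambda> (y \<mapsto> g (y a))\<close> only sees \<open>g\<close> on a finite dimensional ideal \<open>e \<A>\<close>, so it is evaluation
  at an element of that ideal, which becomes \<open>n \<rhd> a\<close>.\<close>

lemma multiplier_of_form:
  fixes \<Lambda> :: "('a::complex_algebra \<Rightarrow> complex) \<Rightarrow> complex"
  assumes units: "central_local_units TYPE('a)"
    and add: "\<And>\<xi> \<eta>. \<xi> \<in> reduced_functionals \<Longrightarrow> \<eta> \<in> reduced_functionals \<Longrightarrow>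
      \<Lambda> (\<lambda>y. \<xi> y + \<eta> y) = \<Lambda> \<xi> + \<Lambda> \<eta>"
    and scale: "\<And>k \<xi>. \<xi> \<in> reduced_functionals \<Longrightarrow> \<Lambda> (\<lambda>y. k * \<xi> y) = k * \<Lambda> \<xi>"
  obtains n where "\<And>g a. clinear g \<Longrightarrow> g (n \<rhd> a) = \<Lambda> (\<lambda>y. g (y * a))"
    "\<And>g a. clinear g \<Longrightarrow> g (a \<lhd> n) = \<Lambda> (\<lambda>y. g (a * y))"
proof -
  note red = translates_reduced[OF units]
  have zero: "(\<lambda>_::'a. 0::complex) \<in> reduced_functionals"
    using red(1)[of "\<lambda>_. 0" 0] by (auto simp: clinear_iff)
  have \<Lambda>_sum: "(\<lambda>y. \<Sum>b\<in>B. k b * \<xi> b y) \<in> reduced_functionals \<and>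
      \<Lambda> (\<lambda>y. \<Sum>b\<in>B. k b * \<xi> b y) = (\<Sum>b\<in>B. k b * \<Lambda> (\<xi> b))"
    if "finite B" "\<And>b. \<xi> b \<in> reduced_functionals" for B :: "'a set" and k \<xi>
    using that(1)
  proof (induction B rule: finite_induct)
    case empty
    show ?case using zero scale[OF zero, of 0] by simp
  next
    case (insert b B)
    then show ?case
      using add[OF reduced_scale[OF units that(2)]] reduced_add[OF units reduced_scale[OF units that(2)]]
      by (simp add: scale[OF that(2)])
  qed
  have ex: "\<exists>x x'. \<forall>g. clinear g \<longrightarrow> g x = \<Lambda> (\<lambda>y. g (y * a)) \<and> g x' = \<Lambda> (\<lambda>y. g (a * y))" for a
  proof -
    obtain e where e: "central_idempotent e" "finite_dimensional (range ((*) e))" "e * a = a"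
      using common_central_unit[OF units, of "{a}"] by auto
    obtain B u where B: "finite B" and u: "\<And>b. clinear (u b)" "\<And>x. e * x = (\<Sum>b\<in>B. u b x *\<^sub>C b)"
      by (rule finite_dimensional_coordinates[OF e(2)], rule that)
    let ?x = "\<Sum>b\<in>B. \<Lambda> (\<lambda>y. u b (y * a)) *\<^sub>C b" and ?x' = "\<Sum>b\<in>B. \<Lambda> (\<lambda>y. u b (a * y)) *\<^sub>C b"
    have "g ?x = \<Lambda> (\<lambda>y. g (y * a)) \<and> g ?x' = \<Lambda> (\<lambda>y. g (a * y))" if g: "clinear g" for g
    proof -
      have expand: "g (e * z) = (\<Sum>b\<in>B. g b * u b z)" for z
        by (simp add: u clinear_sum[OF g] clinear_scaleC[OF g] scaleC_complex mult.commute)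
      have "g (y * a) = (\<Sum>b\<in>B. g b * u b (y * a))" for y
        using supported_by_translates(1)[OF e(1,3) g] expand[of "y * a"]
        by (simp add: supported_by_def mult.assoc)
      moreover have "g (a * y) = (\<Sum>b\<in>B. g b * u b (a * y))" for y
        using expand[of "a * y"] e(3) by (simp add: mult.assoc[symmetric])
      ultimately show ?thesis
        using \<Lambda>_sum[of B "\<lambda>b y. u b (y * a)" g] \<Lambda>_sum[of B "\<lambda>b y. u b (a * y)" g] B red[OF u(1)]
        by (simp add: clinear_sum[OF g] clinear_scaleC[OF g] scaleC_complex mult.commute)
    qed
    then show ?thesis by blast
  qed
  then obtain l r where l: "\<And>g a. clinear g \<Longrightarrow> g (l a) = \<Lambda> (\<lambda>y. g (y * a))"
    and r: "\<And>g a. clinear g \<Longrightarrow> g (r a) = \<Lambda> (\<lambda>y. g (a * y))"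
    by metis
  have "clinear l"
  proof (rule clinearI; rule eq_if_functionals_eq)
    fix g :: "'a \<Rightarrow> complex" and x y k assume g: "clinear g"
    show "g (l (x + y)) = g (l x + l y)"
      unfolding clinear_add[OF g] l[OF g] distrib_left by (rule add[OF red(1)[OF g] red(1)[OF g]])
    show "g (l (k *\<^sub>C x)) = g (k *\<^sub>C l x)"
      unfolding clinear_scaleC[OF g] l[OF g] mult_scaleC_right scaleC_complex by (rule scale[OF red(1)[OF g]])
  qed
  moreover have "clinear r"
  proof (rule clinearI; rule eq_if_functionals_eq)
    fix g :: "'a \<Rightarrow> complex" and x y k assume g: "clinear g"
    show "g (r (x + y)) = g (r x + r y)"
      unfolding clinear_add[OF g] r[OF g] distrib_right by (rule add[OF red(2)[OF g] red(2)[OF g]])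
    show "g (r (k *\<^sub>C x)) = g (k *\<^sub>C r x)"
      unfolding clinear_scaleC[OF g] r[OF g] mult_scaleC_left scaleC_complex by (rule scale[OF red(2)[OF g]])
  qed
  moreover have "r a * b = a * l b" for a b
  proof (rule eq_if_functionals_eq)
    fix g :: "'a \<Rightarrow> complex" assume g: "clinear g"
    show "g (r a * b) = g (a * l b)"
      using r[OF clinear_compose[OF g clinear_times_right], of a b]
        l[OF clinear_compose[OF g clinear_times_left], of a b] by (simp add: mult.assoc)
  qed
  ultimately obtain n where n: "\<And>a. n \<rhd> a = l a" "\<And>a. a \<lhd> n = r a"
    using multiplier_from_pair[of l r] by blast
  show thesis by (rule that[of n]) (simp_all add: n l r)
qed

lemma multiplier_sum_left: "(\<Sum>i\<in>I. m i) \<rhd> a = (\<Sum>i\<in>I. m i \<rhd> a)"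
  and multiplier_sum_right: "a \<lhd> (\<Sum>i\<in>I. m i) = (\<Sum>i\<in>I. a \<lhd> m i)"
proof -
  have "0 \<rhd> a = 0" "a \<lhd> 0 = 0" by (transfer, simp)+
  then show "(\<Sum>i\<in>I. m i) \<rhd> a = (\<Sum>i\<in>I. m i \<rhd> a)" "a \<lhd> (\<Sum>i\<in>I. m i) = (\<Sum>i\<in>I. a \<lhd> m i)"
    by (induction I rule: infinite_finite_induct) (simp_all add: mult_left_add mult_right_add)
qed

text \<open>The coordinates of \<open>slice Y \<xi>\<close> with respect to a basis \<open>S\<close> are linear forms in \<open>\<xi>\<close>. If \<open>n i\<close> is the
  multiplier representing the coordinate at \<open>i\<close>, then \<open>Y\<close> and the sum of the \<open>i \<otimes> n i\<close> have the same
  slices.\<close>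

lemma embed_if_finite_dimensional_slices:
  fixes Y :: "('b::complex_algebra \<otimes> 'a::complex_algebra) multiplier"
  assumes B: "nondegenerate_product TYPE('b)" and A: "nondegenerate_product TYPE('a)"
    and units: "central_local_units TYPE('a)"
    and S0: "finite S0" "\<And>\<xi>. \<xi> \<in> reduced_functionals \<Longrightarrow> slice Y \<xi> \<in> cvec.span S0"
  shows "Y \<in> range multiplier_embed"
proof -
  obtain S where S: "S \<subseteq> S0" "cvec.independent S" "S0 \<subseteq> cvec.span S"
    using cvec.maximal_independent_subset[of S0] by blast
  have fin: "finite S" using S(1) S0(1) by (rule finite_subset)
  have sp: "slice Y \<xi> \<in> cvec.span S" if "\<xi> \<in> reduced_functionals" for \<xi>
    using S0(2)[OF that] cvec.span_minimal[OF S(3) cvec.subspace_span] by blast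
  define c where "c = (\<lambda>i \<xi>. cvec.representation S (slice Y \<xi>) i)"
  have slice_c: "slice Y \<xi> = (\<Sum>i\<in>S. c i \<xi> *\<^sub>C i)" if "\<xi> \<in> reduced_functionals" for \<xi>
    unfolding c_def using cvec.sum_representation_eq[OF S(2) sp[OF that] fin] by simp
  have "\<exists>n. (\<forall>g a. clinear g \<longrightarrow> g (n \<rhd> a) = c i (\<lambda>y. g (y * a))) \<and>
      (\<forall>g a. clinear g \<longrightarrow> g (a \<lhd> n) = c i (\<lambda>y. g (a * y)))" for i
  proof (rule multiplier_of_form[OF units, of "c i"])
    show "c i (\<lambda>y. \<xi> y + \<eta> y) = c i \<xi> + c i \<eta>"
      if "\<xi> \<in> reduced_functionals" "\<eta> \<in> reduced_functionals" for \<xi> \<eta>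
      using that by (simp add: c_def slice_linear(1)[OF B A units] cvec.representation_add[OF S(2)] sp)
    show "c i (\<lambda>y. k * \<xi> y) = k * c i \<xi>" if "\<xi> \<in> reduced_functionals" for k \<xi>
      using that by (simp add: c_def slice_linear(2)[OF B A units] cvec.representation_scale[OF S(2)] sp)
  qed blast
  then obtain n where n: "\<And>i g a. clinear g \<Longrightarrow> g (n i \<rhd> a) = c i (\<lambda>y. g (y * a))"
      "\<And>i g a. clinear g \<Longrightarrow> g (a \<lhd> n i) = c i (\<lambda>y. g (a * y))"
    by metis
  note red = translates_reduced[OF units]
  have "Y = (\<Sum>i\<in>S. multiplier_tens i (n i))"
  proof (rule multiplier_ext_tens; rule tensor_eq_if_slices_eq)
    fix b a and g :: "'a \<Rightarrow> complex" assume g: "clinear g"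
    show "id_tensor_functional g (Y \<rhd> (b \<otimes>\<^sub>t a)) =
        id_tensor_functional g ((\<Sum>i\<in>S. multiplier_tens i (n i)) \<rhd> (b \<otimes>\<^sub>t a))"
      by (simp add: slice_translate(1)[OF B A units g, symmetric] slice_c[OF red(1)[OF g]]
          multiplier_sum_left mult_left_scaleC multiplier_tens_left_tens
          clinear_sum[OF clinear_id_tensor[OF g]] id_tensor_tens[OF g] n(1)[OF g])
    show "id_tensor_functional g ((b \<otimes>\<^sub>t a) \<lhd> Y) =
        id_tensor_functional g ((b \<otimes>\<^sub>t a) \<lhd> (\<Sum>i\<in>S. multiplier_tens i (n i)))"
      by (simp add: slice_translate(2)[OF B A units g, symmetric] slice_c[OF red(2)[OF g]]
          multiplier_sum_right mult_right_scaleC multiplier_tens_right_tens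
          clinear_sum[OF clinear_id_tensor[OF g]] id_tensor_tens[OF g] n(2)[OF g])
  qed
  also have "\<dots> = multiplier_embed (\<Sum>i\<in>S. i \<otimes>\<^sub>t n i)"
    by (simp add: multiplier_embed_def clinear_sum[OF clinear_tensor_lift[OF bilinear_multiplier_tens]]
        tensor_lift_tens[OF bilinear_multiplier_tens])
  finally show ?thesis by blast
qed

theorem theorem3p1:
  fixes \<delta> :: "'a::complex_star_algebra \<Rightarrow> ('a \<otimes> 'a) multiplier"
    and \<phi> :: "'a \<Rightarrow> complex"
    and Y :: "('b::complex_algebra \<otimes> 'a) multiplier"
  assumes "discrete_quantum_group \<delta>"
    and "left_invariant \<delta> \<phi>" and "\<phi> \<noteq> (\<lambda>_. 0)"
    and "nondegenerate_product TYPE('b)"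
  shows "Y \<in> range multiplier_embed \<longleftrightarrow> finite_dimensional {slice Y \<xi> | \<xi>. \<xi> \<in> dual_space \<phi>}"
proof -
  have hopf: "multiplier_hopf_algebra \<delta>" and sum: "direct_sum_of_matrix_algebras TYPE('a)"
    using assms(1) by (simp_all add: discrete_quantum_group_def multiplier_hopf_star_algebra_def)
  have A: "nondegenerate_product TYPE('a)" using hopf by (simp add: multiplier_hopf_algebra_def)
  have units: "central_local_units TYPE('a)"
    using direct_sum_of_matrix_algebras_coordinates[OF sum] matrix_coordinates.central_local_units by blast
  have dual: "dual_space \<phi> = reduced_functionals"
    by (rule dual_space_eq_reduced[OF hopf sum units assms(2,3)])
  have fd: "finite_dimensional {slice Y \<xi> | \<xi>. \<xi> \<in> dual_space \<phi>} \<longleftrightarrow>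
      (\<exists>S. finite S \<and> (\<forall>\<xi>\<in>reduced_functionals. slice Y \<xi> \<in> cvec.span S))"
    unfolding finite_dimensional_def dual by blast
  show ?thesis
    unfolding fd
  proof
    assume "Y \<in> range multiplier_embed"
    then show "\<exists>S. finite S \<and> (\<forall>\<xi>\<in>reduced_functionals. slice Y \<xi> \<in> cvec.span S)"
      using finite_dimensional_slices_embed[OF assms(4) A units] by blast
  next
    assume "\<exists>S. finite S \<and> (\<forall>\<xi>\<in>reduced_functionals. slice Y \<xi> \<in> cvec.span S)"
    then show "Y \<in> range multiplier_embed"
      using embed_if_finite_dimensional_slices[OF assms(4) A units] by blast
  qed
qed

end
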